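(* Let $m\ge1$ and $l$ be integers with $l-m-1\ge1$, let $\{P_0,\dots,P_m\}$ be a symmetric Clifford system on $\mathbb{R}^{2l}$, let $$G_F(x)=|x|^4-\sum_{\alpha=0}^m\langle P_\alpha x,x\rangle^2,\qquad x\in\mathbb{R}^{2l},$$ be the nonnegative polynomial associated with the corresponding OT-FKM type isoparametric polynomial $F$, and assume that $G_F$ is a sum of squares (sos) of real polynomials. For any sos representation of $G_F$, let $r$ denote its rank (i.e. the dimension of the span of the quadratic summands). Write the multiplicity pair as $(m_+,m_-)=(m,l-m-1)$. (1) If $(m_+,m_-)=(1,k)$ with $k\in\mathbb{N}^+$, then $l=k+2\ge3$ and $l-1\le r\le \frac{l(l-1)}{2}$. (2) If $(m_+,m_-)=(2,2k-1)$ with $k\in\mathbb{N}^+$, then $l=2k+2\ge4$ and $l-2\le r\le\frac{l(l-2)}{4}$. (3) If $(m_+,m_-)=(3,4)$, $(4,3)^I$, $(5,2)$ or $(6,1)$, then the rank is unique and equals $r=8-m$. Moreover, in cases (1) and (2), the upper bound can be attained, for instance by the explicit sos representations obtained from Lagrange's identity, whereas the lower bound can be attained if and only if $l=4$ or $l=8$.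
   Context: A symmetric Clifford system on $\mathbb{R}^{2l}$ is a family $\{P_0,\dots,P_m\}$ of real symmetric $2l\times 2l$ matrices with $P_\alpha P_\beta+P_\beta P_\alpha=2\delta_{\alpha\beta}I_{2l}$. The associated OT-FKM type isoparametric polynomial is $F(x)=|x|^4-2\sum_{\alpha=0}^m\langle P_\alpha x,x\rangle^2$, with multiplicity pair $(m_+,m_-)=(m,l-m-1)$, both entries positive, and $G_F=(|x|^4+F)/2$. $(4,3)^I$ means $(m_+,m_-)=(4,3)$ (so $m=4$, $l=8$) with a Clifford system of indefinite class, i.e. $P_0P_1P_2P_3P_4\neq\pm I_{16}$. An sos representation of a polynomial $p$ is an expression $p=\sum_{k=1}^N p_k^2$ with $p_k$ real polynomials; its rank is $r=\dim\operatorname{span}\{p_1,\dots,p_N\}$. Lagrange's identity is the identity $|a|^2|b|^2-\bigl|\sum_i a_i\overline{b_i}\bigr|^2=\sum_{i<j}|a_ib_j-a_jb_i|^2$ for vectors $a,b$ with real or complex entries. *)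

theory Defs
  imports "HOL-Analysis.Analysis" "HOL-Library.Function_Algebras"
begin

text \<open>Real-valued functions as a real vector space under the pointwise operations. Polynomials on
  a Euclidean space are represented by polynomial functions; as \<open>\<real>\<close> is infinite, this does not
  change linear spans and their dimensions.\<close>

interpretation fun_space: vector_space "\<lambda>(c::real) (f::'a \<Rightarrow> real) x. c * f x"
  by unfold_locales (auto simp: fun_eq_iff algebra_simps)

definition symmetric_clifford_system :: "nat \<Rightarrow> (nat \<Rightarrow> real^'n^'n) \<Rightarrow> bool" where
  "symmetric_clifford_system m P \<longleftrightarrow>
     (\<forall>\<alpha>\<le>m. transpose (P \<alpha>) = P \<alpha>) \<and>
     (\<forall>\<alpha>\<le>m. \<forall>\<beta>\<le>m. P \<alpha> ** P \<beta> + P \<beta> ** P \<alpha> = (if \<alpha> = \<beta> then mat 2 else 0))"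

definition F_poly :: "nat \<Rightarrow> (nat \<Rightarrow> real^'n^'n) \<Rightarrow> real^'n \<Rightarrow> real" where
  "F_poly m P x = norm x ^ 4 - 2 * (\<Sum>\<alpha>\<le>m. ((P \<alpha> *v x) \<bullet> x)\<^sup>2)"

definition G_poly :: "nat \<Rightarrow> (nat \<Rightarrow> real^'n^'n) \<Rightarrow> real^'n \<Rightarrow> real" where
  "G_poly m P x = norm x ^ 4 - (\<Sum>\<alpha>\<le>m. ((P \<alpha> *v x) \<bullet> x)\<^sup>2)"

lemma G_poly_eq_F_poly: "G_poly m P x = (norm x ^ 4 + F_poly m P x) / 2"
  by (simp add: G_poly_def F_poly_def field_simps)

text \<open>The pair \<open>(m\<^sub>+, m\<^sub>-)\<close>; only meaningful for \<open>l \<ge> m + 2\<close>, where the subtraction does not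
  truncate.\<close>

definition multiplicities :: "nat \<Rightarrow> nat \<Rightarrow> nat \<times> nat" where
  "multiplicities m l = (m, l - m - 1)"

text \<open>The indefinite class for \<open>m = 4\<close>.\<close>

definition indefinite_class :: "(nat \<Rightarrow> real^'n^'n) \<Rightarrow> bool" where
  "indefinite_class P \<longleftrightarrow>
     P 0 ** P 1 ** P 2 ** P 3 ** P 4 \<noteq> mat 1 \<and> P 0 ** P 1 ** P 2 ** P 3 ** P 4 \<noteq> - mat 1"

definition sos_representation ::
    "('a::real_normed_vector \<Rightarrow> real) \<Rightarrow> ('a \<Rightarrow> real) list \<Rightarrow> bool" where
  "sos_representation p ps \<longleftrightarrow>
     (\<forall>q\<in>set ps. real_polynomial_function q) \<and> (\<forall>x. p x = (\<Sum>q\<leftarrow>ps. (q x)\<^sup>2))"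

definition is_sos :: "('a::real_normed_vector \<Rightarrow> real) \<Rightarrow> bool" where
  "is_sos p \<longleftrightarrow> (\<exists>ps. sos_representation p ps)"

definition sos_rank :: "('a \<Rightarrow> real) list \<Rightarrow> nat" where
  "sos_rank ps = fun_space.dim (fun_space.span (set ps))"

text \<open>Orthogonal coordinates \<open>x \<mapsto> (a, b)\<close>, a linear isometry of \<open>'v\<close> into \<open>K\<^sup>n \<oplus> K\<^sup>n\<close> with
  \<open>K = \<real>\<close> or \<open>K = \<complex>\<close>; when the real dimensions agree, it is onto.\<close>

definition isometric_coordinates ::
    "nat \<Rightarrow> (nat \<Rightarrow> 'v::real_normed_vector \<Rightarrow> 'k::real_normed_vector)
      \<Rightarrow> (nat \<Rightarrow> 'v \<Rightarrow> 'k) \<Rightarrow> bool" where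
  "isometric_coordinates n a b \<longleftrightarrow>
     (\<forall>i<n. linear (a i) \<and> linear (b i)) \<and>
     (\<forall>x. (norm x)\<^sup>2 = (\<Sum>i<n. (norm (a i x))\<^sup>2) + (\<Sum>i<n. (norm (b i x))\<^sup>2))"

text \<open>Sos representations read off from Lagrange's identity: in suitable orthogonal coordinates \<open>p\<close> is
  four times the left-hand side of the identity, and \<open>ps\<close> lists the terms on its right-hand side,
  scaled by \<open>2\<close>. In the complex case each squared modulus contributes the squares of its real and
  imaginary parts.\<close>

definition real_lagrange_representation ::
    "nat \<Rightarrow> ('v::real_normed_vector \<Rightarrow> real) \<Rightarrow> ('v \<Rightarrow> real) list \<Rightarrow> bool" where
  "real_lagrange_representation n p ps \<longleftrightarrow>
     (\<exists>a b :: nat \<Rightarrow> 'v \<Rightarrow> real. isometric_coordinates n a b \<and>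
       (\<forall>x. p x = 4 * ((\<Sum>i<n. (a i x)\<^sup>2) * (\<Sum>i<n. (b i x)\<^sup>2) - (\<Sum>i<n. a i x * b i x)\<^sup>2)) \<and>
       ps = [\<lambda>x. 2 * (a i x * b j x - a j x * b i x). j \<leftarrow> [0..<n], i \<leftarrow> [0..<j]])"

definition complex_lagrange_representation ::
    "nat \<Rightarrow> ('v::real_normed_vector \<Rightarrow> real) \<Rightarrow> ('v \<Rightarrow> real) list \<Rightarrow> bool" where
  "complex_lagrange_representation n p ps \<longleftrightarrow>
     (\<exists>a b :: nat \<Rightarrow> 'v \<Rightarrow> complex. isometric_coordinates n a b \<and>
       (\<forall>x. p x = 4 * ((\<Sum>i<n. (cmod (a i x))\<^sup>2) * (\<Sum>i<n. (cmod (b i x))\<^sup>2)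
                        - (cmod (\<Sum>i<n. a i x * cnj (b i x)))\<^sup>2)) \<and>
       ps = [\<lambda>x. 2 * h (a i x * b j x - a j x * b i x). j \<leftarrow> [0..<n], i \<leftarrow> [0..<j], h \<leftarrow> [Re, Im]])"

end

theory Submission
  imports Defs
begin

text \<open>Growth forces every summand to be a quadratic form \<open>q\<close>, and since \<open>q\<close> vanishes on the eigenspaces of
  each \<open>P\<^sub>\<alpha>\<close>, its symmetric operator \<open>Q\<close> anticommutes with all \<open>P\<^sub>\<alpha>\<close>. For a unit vector \<open>x\<close> with
  \<open>P\<^sub>0x = x\<close> the vectors \<open>P\<^sub>\<alpha>x\<close> (\<open>1 \<le> \<alpha> \<le> m\<close>) and \<open>Qx\<close> form a Parseval frame of the \<open>(-1)\<close>-eigenspace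
  of \<open>P\<^sub>0\<close>, which has dimension \<open>l\<close>; hence \<open>r \<ge> l - m\<close>. In case of equality the frame is an orthonormal
  basis, the \<open>Q\<close> of a reduced representation extend the Clifford system to one with \<open>l + 1\<close> members on
  \<open>\<real>\<^bsup>2l\<^esup>\<close>, and Hurwitz's argument gives \<open>l = 4\<close> or \<open>l = 8\<close>. Conversely, for these \<open>l\<close> the squares
  in Lagrange's identity can be combined by means of the Pluecker relation.

  For \<open>m = 1, 2\<close> anticommutation with the \<open>P\<^sub>\<alpha>\<close> says exactly that \<open>q\<close> is in the span of the terms
  of the real or complex Lagrange identity, which are linearly independent. For \<open>m \<ge> 3\<close> adding
  the squares of \<open>\<langle>P\<^sub>\<alpha>x, x\<rangle>\<close>, \<open>\<alpha> \<ge> 4\<close>, gives a representation for \<open>m = 3\<close>, and there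
  quaternionic symmetry shows that \<open>q \<mapsto> Qx\<close> is injective on the span of the summands, hence
  \<open>r \<le> l - m\<close>.\<close>

section \<open>Linear algebra\<close>

text \<open>Let b be the polarization of a summand q. For x and y in the two eigenspaces of P_0,
  only the mixed term 2 b(x, y) of q(x + y) survives, and the polynomial equation becomes |x|^2
  |y|^2 = sum of <P_\<alpha> x, y>^2 + sum of b(x, y)^2. This holds for every x separately, so
  statements about ranks turn into counts of vectors in a space of dimension l. The obstacle in the
  case of equality is that the frame has one vector per summand, while the rank only sees the span,
  so a long list may hide a small rank. The upper bound for m \<ge> 3 requires q to be determined by
  Qx at a single x. Identifying the eigenspaces through P_1 makes the forms skew, and a skew form
  has no diagonal values to compare. Identifying them through P_1 P_2 P_3 makes the forms symmetric,
  and their diagonal values are what the argument controls.\<close>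

lemma (in vector_space) exists_relation:
  assumes "finite I" "finite B" "f ` I \<subseteq> span B" "card B < card I"
  shows "\<exists>u. (\<exists>i\<in>I. u i \<noteq> 0) \<and> (\<Sum>i\<in>I. scale (u i) (f i)) = 0"
proof (cases "inj_on f I")
  case True
  have "dependent (f ` I)"
  proof (rule ccontr)
    assume "\<not> dependent (f ` I)"
    then have "card (f ` I) \<le> card B"
      using independent_span_bound assms by blast
    then show False
      using assms(4) card_image[OF True] by simp
  qed
  then obtain u where u: "\<exists>v\<in>f ` I. u v \<noteq> 0" "(\<Sum>v\<in>f ` I. scale (u v) v) = 0"
    using dependent_finite[of "f ` I"] assms(1) by auto
  have "(\<Sum>i\<in>I. scale (u (f i)) (f i)) = 0"
    using u(2) sum.reindex[OF True, of "\<lambda>v. scale (u v) v"] by simp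
  then show ?thesis
    using u(1) by (intro exI[of _ "\<lambda>i. u (f i)"]) auto
next
  case False
  then obtain i j where ij: "i \<in> I" "j \<in> I" "i \<noteq> j" "f i = f j"
    by (auto simp: inj_on_def)
  \<comment> \<open>Indexing by \<open>I\<close> keeps repetitions apart, as is necessary for lists
    of summands. Two equal members already give a relation, with coefficients 1 and -1.\<close>
  define u where "u = (\<lambda>k. if k = i then 1 else if k = j then - 1 else (0::'a))"
  have "(\<Sum>k\<in>I. scale (u k) (f k)) = (\<Sum>k\<in>{i, j}. scale (u k) (f k))"
    using ij assms(1) by (intro sum.mono_neutral_right) (auto simp: u_def)
  also have "\<dots> = 0"
    using ij by (simp add: u_def)
  finally show ?thesis
    using ij(1) by (intro exI[of _ u]) (auto simp: u_def)
qed

text \<open>Indexed rather than a set of vectors: distinct indices are then forced to carry distinct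
  vectors, and families over disjoint sums such as \<open>{1..m} <+> {..<n}\<close> can be
  formed.\<close>

definition orthonormal_family :: "'i set \<Rightarrow> ('i \<Rightarrow> 'a::real_inner) \<Rightarrow> bool" where
  "orthonormal_family I w \<longleftrightarrow> (\<forall>i\<in>I. \<forall>j\<in>I. w i \<bullet> w j = (if i = j then 1 else 0))"

text \<open>The bound \<open>dim S \<le> card I\<close> makes the family span \<open>S\<close>, so
  the residual of the expansion lies in a span to which it is orthogonal.\<close>

lemma orthonormal_family_expansion:
  fixes w :: "'i \<Rightarrow> 'a::euclidean_space"
  assumes I: "finite I" and on: "orthonormal_family I w" and wS: "w ` I \<subseteq> S"
    and S: "subspace S" and d: "dim S \<le> card I" and x: "x \<in> S"
  shows "x = (\<Sum>i\<in>I. (w i \<bullet> x) *\<^sub>R w i)"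
proof -
  have inj: "inj_on w I"
    using on unfolding orthonormal_family_def inj_on_def by (metis zero_neq_one)
  have "pairwise orthogonal (w ` I)" "0 \<notin> w ` I"
    using on unfolding orthonormal_family_def pairwise_def orthogonal_def
    by (auto, metis inner_zero_left zero_neq_one)
  then have ind: "independent (w ` I)"
    by (rule pairwise_orthogonal_independent)
  have "S \<subseteq> span (w ` I)"
    using card_ge_dim_independent[OF wS ind] d card_image[OF inj] by simp
  define z where "z = x - (\<Sum>i\<in>I. (w i \<bullet> x) *\<^sub>R w i)"
  have "w j \<bullet> z = 0" if "j \<in> I" for j
  proof -
    have "w j \<bullet> (\<Sum>i\<in>I. (w i \<bullet> x) *\<^sub>R w i) = (\<Sum>i\<in>I. if i = j then w i \<bullet> x else 0)"
      unfolding inner_sum_right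
      by (intro sum.cong refl) (use on that in \<open>auto simp: orthonormal_family_def\<close>)
    also have "\<dots> = w j \<bullet> x"
      using I that by simp
    finally show ?thesis
      by (simp add: z_def inner_diff_right)
  qed
  then have orth: "orthogonal z y" if "y \<in> w ` I" for y
    using that by (auto simp: orthogonal_def inner_commute)
  have "z \<in> S"
    unfolding z_def using S x wS by (intro subspace_diff subspace_sum subspace_scale) auto
  then have "z \<in> span (w ` I)"
    using \<open>S \<subseteq> span (w ` I)\<close> by blast
  then have "orthogonal z z"
    using orthogonal_to_span orth by blast
  then show ?thesis
    by (simp add: z_def orthogonal_self)
qed

lemma orthonormal_family_parseval:
  fixes w :: "'i \<Rightarrow> 'a::euclidean_space"
  assumes "finite I" "orthonormal_family I w" "w ` I \<subseteq> S" "subspace S" "dim S \<le> card I" "x \<in> S"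
  shows "x \<bullet> y = (\<Sum>i\<in>I. (w i \<bullet> x) * (w i \<bullet> y))"
  by (subst orthonormal_family_expansion[OF assms]) (simp add: inner_sum_left)

lemma orthonormal_family_exists:
  fixes S :: "'a::euclidean_space set"
  assumes "subspace S"
  obtains w where "orthonormal_family {..<dim S} w" "w ` {..<dim S} \<subseteq> S"
proof -
  obtain B where B: "B \<subseteq> S" "pairwise orthogonal B" "\<And>x. x \<in> B \<Longrightarrow> norm x = 1"
    "independent B" "card B = dim S"
    using orthonormal_basis_subspace[OF assms] by metis
  obtain w where w: "bij_betw w {..<card B} B"
    using ex_bij_betw_nat_finite[OF finiteI_independent[OF B(4)]] by (auto simp: atLeast0LessThan)
  have "orthonormal_family {..<card B} w"
    unfolding orthonormal_family_def
  proof (intro ballI)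
    fix i j assume ij: "i \<in> {..<card B}" "j \<in> {..<card B}"
    then have wB: "w i \<in> B" "w j \<in> B"
      using w by (auto simp: bij_betw_def)
    show "w i \<bullet> w j = (if i = j then 1 else 0)"
    proof (cases "i = j")
      case True
      then show ?thesis using B(3)[OF wB(1)] by (simp add: norm_eq_1)
    next
      case False
      then have "w i \<noteq> w j"
        using w ij by (auto simp: bij_betw_def inj_on_def)
      then show ?thesis
        using B(2) wB False by (auto simp: pairwise_def orthogonal_def)
    qed
  qed
  moreover have "w ` {..<card B} \<subseteq> S"
    using w B(1) by (auto simp: bij_betw_def)
  ultimately show thesis
    using that B(5) by simp
qed

text \<open>Applying the frame identity to a frame vector shows that its norm is at most 1. Double
  counting against an orthonormal basis of \<open>S\<close> shows that the squared norms add up to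
  \<open>dim S\<close>. With at most \<open>dim S\<close> vectors all norms are therefore 1, and the
  identity at \<open>w k\<close> leaves no room for inner products with the others.\<close>

lemma orthonormal_if_parseval_frame:
  fixes w :: "'i \<Rightarrow> 'a::euclidean_space"
  assumes I: "finite I" and S: "subspace S" and wS: "w ` I \<subseteq> S" and card: "card I \<le> dim S"
    and frame: "\<And>y. y \<in> S \<Longrightarrow> y \<bullet> y = (\<Sum>i\<in>I. (w i \<bullet> y)\<^sup>2)"
  shows "orthonormal_family I w"
proof -
  have le1: "w k \<bullet> w k \<le> 1" if k: "k \<in> I" for k
  proof -
    have "(w k \<bullet> w k)\<^sup>2 \<le> (\<Sum>i\<in>I. (w i \<bullet> w k)\<^sup>2)"
      using I k by (intro member_le_sum) auto
    also have "\<dots> = w k \<bullet> w k"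
      using frame[of "w k"] wS k by auto
    finally have "w k \<bullet> w k * (w k \<bullet> w k) \<le> w k \<bullet> w k * 1"
      by (simp add: power2_eq_square)
    moreover have "w k \<bullet> w k = 0 \<or> 0 < w k \<bullet> w k"
      by simp
    ultimately show ?thesis
      by (auto simp: mult_le_cancel_left_pos simp del: inner_gt_zero_iff)
  qed
  obtain e where e: "orthonormal_family {..<dim S} e" "e ` {..<dim S} \<subseteq> S"
    using orthonormal_family_exists[OF S] .
  have "(\<Sum>i\<in>I. w i \<bullet> w i) = (\<Sum>i\<in>I. \<Sum>k<dim S. (e k \<bullet> w i) * (e k \<bullet> w i))"
    using wS by (intro sum.cong refl orthonormal_family_parseval[OF _ e S]) auto
  also have "\<dots> = (\<Sum>k<dim S. \<Sum>i\<in>I. (w i \<bullet> e k)\<^sup>2)"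
    by (subst sum.swap) (simp add: power2_eq_square inner_commute)
  also have "\<dots> = (\<Sum>k<dim S. e k \<bullet> e k)"
    using e(2) by (intro sum.cong refl frame[symmetric]) auto
  also have "\<dots> = dim S"
    using e(1) by (simp add: orthonormal_family_def)
  finally have "(\<Sum>i\<in>I. 1 - w i \<bullet> w i) \<le> 0"
    using card by (simp add: sum_subtractf)
  moreover have "(\<Sum>i\<in>I. 1 - w i \<bullet> w i) \<ge> 0"
    using le1 by (intro sum_nonneg) auto
  ultimately have "(\<Sum>i\<in>I. 1 - w i \<bullet> w i) = 0"
    by simp
  then have one: "w k \<bullet> w k = 1" if "k \<in> I" for k
    using that I le1 by (subst (asm) sum_nonneg_eq_0_iff) auto
  have "w i \<bullet> w k = 0" if "i \<in> I" "k \<in> I" "i \<noteq> k" for i k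
  proof -
    have "1 = (\<Sum>i\<in>I. (w i \<bullet> w k)\<^sup>2)"
      using frame[of "w k"] one that(2) wS by auto
    also have "\<dots> = 1 + (\<Sum>i\<in>I - {k}. (w i \<bullet> w k)\<^sup>2)"
      using I that(2) one by (subst sum.remove[of _ k]) auto
    finally have "(\<Sum>i\<in>I - {k}. (w i \<bullet> w k)\<^sup>2) = 0"
      by simp
    then show ?thesis
      using I that by (subst (asm) sum_nonneg_eq_0_iff) auto
  qed
  then show ?thesis
    using one by (auto simp: orthonormal_family_def)
qed

section \<open>Anticommuting involutions and complex structures\<close>

lemma subspace_eigenspace:
  assumes "subspace S" "linear T"
  shows "subspace {x \<in> S. T x = c *\<^sub>R x}"
  using assms unfolding subspace_def
  by (auto simp: linear_0 linear_add linear_scale scaleR_add_right)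

text \<open>\<open>A\<close> exchanges the two eigenspaces of \<open>T\<close> on \<open>S\<close>,
  and \<open>S\<close> is their direct sum because \<open>T\<close> is an involution there.\<close>

lemma dim_anticommuting_involutions:
  fixes S :: "'a::euclidean_space set"
  assumes S: "subspace S" and T: "linear T" "T ` S \<subseteq> S" "\<And>x. x \<in> S \<Longrightarrow> T (T x) = x"
    and A: "linear A" "A ` S \<subseteq> S" "\<And>x. x \<in> S \<Longrightarrow> A (A x) = x"
    and anti: "\<And>x. x \<in> S \<Longrightarrow> T (A x) = - A (T x)"
  shows "dim {x \<in> S. T x = - x} = dim {x \<in> S. T x = x}"
    and "dim S = 2 * dim {x \<in> S. T x = x}"
proof -
  let ?p = "{x \<in> S. T x = x}" and ?m = "{x \<in> S. T x = - x}"
  have sub: "subspace ?p" "subspace ?m"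
    using subspace_eigenspace[OF S T(1), of 1] subspace_eigenspace[OF S T(1), of "- 1"] by simp_all
  have "A ` ?p = ?m"
  proof
    show "A ` ?p \<subseteq> ?m"
      using A(2) anti by auto
    show "?m \<subseteq> A ` ?p"
    proof
      fix x assume x: "x \<in> ?m"
      then have "A x \<in> ?p"
        using A(2) anti by (auto simp: linear_neg[OF A(1)])
      moreover have "x = A (A x)"
        using x A(3) by simp
      ultimately show "x \<in> A ` ?p"
        by blast
    qed
  qed
  moreover have "inj_on A (span ?p)"
    unfolding span_eq_iff[THEN iffD2, OF sub(1)] using A(3)
    by (auto simp: inj_on_def) (metis)
  ultimately show eq: "dim ?m = dim ?p"
    using dim_image_eq[OF A(1), of ?p] by simp
  have "S = {x + y |x y. x \<in> ?p \<and> y \<in> ?m}"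
  proof
    show "{x + y |x y. x \<in> ?p \<and> y \<in> ?m} \<subseteq> S"
      using S by (auto intro: subspace_add)
    show "S \<subseteq> {x + y |x y. x \<in> ?p \<and> y \<in> ?m}"
    proof
      fix x assume x: "x \<in> S"
      define y z where "y = (1/2) *\<^sub>R (x + T x)" and "z = (1/2) *\<^sub>R (x - T x)"
      have "y + z = (1/2 + 1/2) *\<^sub>R x"
        unfolding y_def z_def scaleR_left_distrib
        by (simp add: scaleR_right_distrib scaleR_right_diff_distrib)
      then have "x = y + z"
        by simp
      moreover have "y \<in> S" "z \<in> S"
        unfolding y_def z_def using S x T(2) by (auto intro!: subspace_scale subspace_add subspace_diff)
      moreover have "T y = y" "T z = - z"
        unfolding y_def z_def using T(3)[OF x]
        by (simp_all add: linear_scale[OF T(1)] linear_add[OF T(1)] linear_diff[OF T(1)] algebra_simps)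
      ultimately show "x \<in> {x + y |x y. x \<in> ?p \<and> y \<in> ?m}"
        by blast
    qed
  qed
  moreover have "?p \<inter> ?m = {0}"
  proof -
    have "x = 0" if "x = - x" for x :: 'a
      using that by (simp add: eq_neg_iff_add_eq_0 flip: scaleR_2)
    then show ?thesis
      using sub by (auto simp: subspace_0 dest: subspace_0)
  qed
  ultimately show "dim S = 2 * dim ?p"
    using dim_sums_Int[OF sub] eq by simp
qed

text \<open>Splitting off the \<open>J\<close>-invariant plane of a unit vector \<open>v\<close> and
  \<open>J v\<close> leaves an orthogonal complement that is again \<open>J\<close>-invariant. The
  \<open>u i\<close> are a unitary basis: together with the \<open>J (u i)\<close> they form a real
  orthonormal basis. The lemma yields both the parity needed for the Hurwitz condition and the
  coordinates of the complex Lagrange identity.\<close>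

lemma complex_structure_basis:
  fixes S :: "'a::euclidean_space set"
  assumes "subspace S" and J: "linear J" "J ` S \<subseteq> S" "\<And>x. x \<in> S \<Longrightarrow> J (J x) = - x"
    "\<And>x y. J x \<bullet> y = - (x \<bullet> J y)"
  shows "\<exists>n u. dim S = 2 * n \<and> u ` {..<n} \<subseteq> S \<and> orthonormal_family {..<n} u \<and>
    (\<forall>i<n. \<forall>j<n. u i \<bullet> J (u j) = 0)"
  using assms(1-3) assms(4)
proof (induction "dim S" arbitrary: S rule: less_induct)
  case less
  have skew0: "x \<bullet> J x = 0" for x
    using J(4)[of x x] by (simp add: inner_commute)
  show ?case
  proof (cases "dim S = 0")
    case True
    then show ?thesis
      by (intro exI[of _ 0]) (auto simp: orthonormal_family_def)
  next
    case False
    then obtain v0 where v0: "v0 \<in> S" "v0 \<noteq> 0"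
      using dim_eq_0[of S] by auto
    define v where "v = v0 /\<^sub>R norm v0"
    have v: "v \<in> S" "v \<bullet> v = 1"
      using v0 less.prems(1) by (auto simp: v_def subspace_scale dot_square_norm power2_eq_square)
    have JvS: "J v \<in> S" and JJv: "J (J v) = - v"
      using v less.prems by auto
    have Jv: "J v \<bullet> J v = 1"
      using J(4)[of v "J v"] v JJv by (simp add: inner_commute)
    have vJv: "v \<bullet> J v = 0" "J v \<bullet> v = 0"
      using skew0[of v] by (simp_all add: inner_commute)
    define S' where "S' = {y \<in> S. \<forall>x\<in>span {v, J v}. orthogonal x y}"
    have S'_iff: "y \<in> S' \<longleftrightarrow> y \<in> S \<and> v \<bullet> y = 0 \<and> J v \<bullet> y = 0" for y
    proof
      assume "y \<in> S'"
      then show "y \<in> S \<and> v \<bullet> y = 0 \<and> J v \<bullet> y = 0"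
        by (auto simp: S'_def orthogonal_def span_base)
    next
      assume y: "y \<in> S \<and> v \<bullet> y = 0 \<and> J v \<bullet> y = 0"
      have "orthogonal y x" if "x \<in> span {v, J v}" for x
        by (rule orthogonal_to_span[OF that]) (use y in \<open>auto simp: orthogonal_def inner_commute[of y]\<close>)
      then show "y \<in> S'"
        using y by (auto simp: S'_def orthogonal_commute)
    qed
    have "v \<noteq> J v"
      using v vJv by auto
    moreover have "independent {v, J v}"
      using v Jv vJv by (intro pairwise_orthogonal_independent) (auto simp: pairwise_def orthogonal_def)
    ultimately have "dim (span {v, J v}) = 2"
      by (simp add: dim_eq_card_independent)
    moreover have "span {v, J v} \<subseteq> S"
      using v JvS less.prems(1) by (intro span_minimal) auto
    ultimately have d: "dim S' + 2 = dim S"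
      using dim_subspace_orthogonal_to_vectors[OF subspace_span less.prems(1), of "{v, J v}"]
      by (simp add: S'_def)
    have sub: "subspace S'"
      using less.prems(1) unfolding subspace_def by (auto simp: S'_iff inner_add_right)
    have "J y \<in> S'" if "y \<in> S'" for y
      using that J(4)[of v y] J(4)[of "J v" y] JJv less.prems(3) by (auto simp: S'_iff)
    then have "J ` S' \<subseteq> S'"
      by blast
    then obtain n u where u: "dim S' = 2 * n" "u ` {..<n} \<subseteq> S'" "orthonormal_family {..<n} u"
      "\<forall>i<n. \<forall>j<n. u i \<bullet> J (u j) = 0"
      using less.hyps[of S'] d sub J(1) less.prems(4) by (auto simp: S'_iff)
    define w where "w = (\<lambda>i. if i < n then u i else v)"
    have uS: "u i \<in> S" "v \<bullet> u i = 0" "J v \<bullet> u i = 0" "u i \<bullet> v = 0" "u i \<bullet> J v = 0" "v \<bullet> J (u i) = 0" if "i < n" for i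
      using u(2) that J(4)[of v "u i"] by (auto simp: S'_iff image_subset_iff inner_commute)
    show ?thesis
    proof (intro exI conjI)
      show "dim S = 2 * Suc n"
        using d u(1) by simp
      show "w ` {..<Suc n} \<subseteq> S"
        using uS v by (auto simp: w_def)
      show "orthonormal_family {..<Suc n} w"
        using u(3) v uS by (auto simp: orthonormal_family_def w_def)
      show "\<forall>i<Suc n. \<forall>j<Suc n. w i \<bullet> J (w j) = 0"
        using u(4) vJv uS by (auto simp: w_def)
    qed
  qed
qed

section \<open>Quadratic forms and sums of squares\<close>

definition polar :: "('a::real_vector \<Rightarrow> real) \<Rightarrow> 'a \<Rightarrow> 'a \<Rightarrow> real" where
  "polar q x y = (q (x + y) - q x - q y) / 2"

text \<open>Bilinearity of \<open>polar q\<close> still admits a linear part of \<open>q\<close>,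
  because \<open>polar\<close> vanishes on linear functionals. The second condition excludes
  it.\<close>

definition quadratic_form :: "('a::real_vector \<Rightarrow> real) \<Rightarrow> bool" where
  "quadratic_form q \<longleftrightarrow> bilinear (polar q) \<and> (\<forall>x. polar q x x = q x)"

lemma polar_commute: "polar q x y = polar q y x"
  by (simp add: polar_def add.commute)

lemma subspace_quadratic_form: "fun_space.subspace {q. quadratic_form q}"
proof (rule fun_space.subspaceI)
  have polar0: "polar (0::'a \<Rightarrow> real) = (\<lambda>x y. 0)"
    by (simp add: polar_def fun_eq_iff)
  show "0 \<in> {q::'a \<Rightarrow> real. quadratic_form q}"
    by (auto simp: quadratic_form_def polar0 bilinear_def module_hom_zero)
next
  fix f g :: "'a \<Rightarrow> real" assume fg: "f \<in> {q. quadratic_form q}" "g \<in> {q. quadratic_form q}"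
  have "polar (f + g) = (\<lambda>x y. polar f x y + polar g x y)"
    by (simp add: polar_def fun_eq_iff field_simps)
  with fg show "f + g \<in> {q. quadratic_form q}"
    by (auto simp: quadratic_form_def bilinear_def intro!: linear_compose_add)
next
  fix c and f :: "'a \<Rightarrow> real" assume f: "f \<in> {q. quadratic_form q}"
  have "polar (\<lambda>x. c * f x) = (\<lambda>x y. c * polar f x y)"
    by (simp add: polar_def fun_eq_iff field_simps)
  moreover have "linear (\<lambda>y. c * g y)" if "linear g" for g :: "'a \<Rightarrow> real"
    using linear_compose_scale_right[OF that, of c] by simp
  ultimately show "(\<lambda>x. c * f x) \<in> {q. quadratic_form q}"
    using f by (auto simp: quadratic_form_def bilinear_def)
qed

section \<open>Quadratic growth forces a quadratic form\<close>

lemma real_polynomial_function_on_line: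
  assumes "real_polynomial_function q"
  shows "\<exists>p. \<forall>t. q (x + t *\<^sub>R y) = poly p t"
  using assms
proof induction
  case (linear f)
  interpret bounded_linear f by fact
  show ?case
    by (intro exI[of _ "[:f x, f y:]"]) (simp add: add scaleR)
next
  case (const c)
  show ?case
    by (intro exI[of _ "[:c:]"]) simp
next
  case (add f g)
  then show ?case
    by (metis poly_add)
next
  case (mult f g)
  then show ?case
    by (metis poly_mult)
qed

text \<open>In degree 3 or more, \<open>poly p t / t ^ degree p\<close> would tend both to the
  leading coefficient and to 0.\<close>

lemma degree_le_2_if_quadratic_growth:
  fixes p :: "real poly"
  assumes bound: "\<And>t. \<bar>poly p t\<bar> \<le> K * (1 + \<bar>t\<bar>)\<^sup>2"
  shows "degree p \<le> 2"
proof (rule ccontr)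
  assume "\<not> degree p \<le> 2"
  then have d: "degree p \<ge> 3"
    by simp
  have K: "K \<ge> 0"
    using bound[of 0] by simp
  have "((\<lambda>t. poly p t / t ^ degree p) \<longlongrightarrow> lead_coeff p) at_top"
    using poly_divide_tendsto_aux[of p] at_top_le_at_infinity by (rule tendsto_mono[rotated])
  moreover have "((\<lambda>t. poly p t / t ^ degree p) \<longlongrightarrow> 0) at_top"
  proof (rule Lim_null_comparison)
    show "((\<lambda>t. 4 * K * inverse t) \<longlongrightarrow> 0) at_top"
      using tendsto_mult_right_zero[OF tendsto_inverse_0_at_top[OF filterlim_ident], of "4 * K"] .
    show "\<forall>\<^sub>F t in at_top. norm (poly p t / t ^ degree p) \<le> 4 * K * inverse t"
      using eventually_ge_at_top[of 1]
    proof eventually_elim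
      case (elim t)
      have "\<bar>poly p t\<bar> \<le> K * (1 + t)\<^sup>2"
        using bound[of t] elim by simp
      also have "\<dots> \<le> K * (2 * t)\<^sup>2"
        using K elim by (intro mult_left_mono power_mono) auto
      also have "\<dots> = 4 * K * inverse t * t ^ 3"
        using elim by (simp add: power2_eq_square power3_eq_cube)
      also have "\<dots> \<le> 4 * K * inverse t * t ^ degree p"
        using K elim d by (intro mult_left_mono power_increasing) auto
      finally show ?case
        using elim by (simp add: divide_le_eq)
    qed
  qed
  ultimately have "lead_coeff p = 0"
    using tendsto_unique trivial_limit_at_top_linorder by blast
  then show False
    using d by simp
qed

text \<open>Restriction to lines replaces the degree in several variables by the degree of a
  univariate polynomial, which the growth bound controls.\<close>

lemma quadratic_on_lines:
  fixes q :: "'a::real_normed_vector \<Rightarrow> real"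
  assumes q: "real_polynomial_function q" and bound: "\<And>v. \<bar>q v\<bar> \<le> (norm v)\<^sup>2"
  shows "\<exists>c\<^sub>0 c\<^sub>1 c\<^sub>2. \<forall>t. q (x + t *\<^sub>R y) = c\<^sub>0 + c\<^sub>1 * t + c\<^sub>2 * t\<^sup>2"
proof -
  obtain p where p: "\<And>t. q (x + t *\<^sub>R y) = poly p t"
    using real_polynomial_function_on_line[OF q] by blast
  have "\<bar>poly p t\<bar> \<le> (norm x + norm y)\<^sup>2 * (1 + \<bar>t\<bar>)\<^sup>2" for t
  proof -
    have "\<bar>poly p t\<bar> \<le> (norm (x + t *\<^sub>R y))\<^sup>2"
      using bound p by metis
    also have "\<dots> \<le> ((norm x + norm y) * (1 + \<bar>t\<bar>))\<^sup>2"
    proof (rule power_mono)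
      have "norm (x + t *\<^sub>R y) \<le> norm x + \<bar>t\<bar> * norm y"
        by (metis norm_scaleR norm_triangle_ineq)
      also have "\<dots> \<le> (norm x + norm y) * (1 + \<bar>t\<bar>)"
        by (simp add: algebra_simps)
      finally show "norm (x + t *\<^sub>R y) \<le> (norm x + norm y) * (1 + \<bar>t\<bar>)" .
    qed simp
    finally show ?thesis
      by (simp add: power_mult_distrib)
  qed
  then have deg: "degree p \<le> 2"
    by (rule degree_le_2_if_quadratic_growth)
  have "p = [:coeff p 0, coeff p 1, coeff p 2:]"
    using deg by (intro poly_eqI) (auto simp: coeff_pCons coeff_eq_0 numeral_2_eq_2 split: nat.split)
  then obtain c\<^sub>0 c\<^sub>1 c\<^sub>2 where "p = [:c\<^sub>0, c\<^sub>1, c\<^sub>2:]"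
    by blast
  then have "poly p t = c\<^sub>0 + c\<^sub>1 * t + c\<^sub>2 * t\<^sup>2" for t
    by (simp add: algebra_simps power2_eq_square)
  then show ?thesis
    using p by auto
qed

text \<open>A Jordan-von Neumann argument: homogeneity of degree 2 and the parallelogram law are
  read off along lines, and together they make the polarization additive.\<close>

lemma quadratic_form_if_quadratic_growth:
  fixes q :: "'a::real_normed_vector \<Rightarrow> real"
  assumes q: "real_polynomial_function q" and bound: "\<And>v. \<bar>q v\<bar> \<le> (norm v)\<^sup>2"
  shows "quadratic_form q"
proof -
  note line = quadratic_on_lines[OF q bound]
  have hom: "q (t *\<^sub>R y) = t\<^sup>2 * q y" for t y
  proof -
    obtain c\<^sub>0 c\<^sub>1 c\<^sub>2 where c: "\<And>t. q (t *\<^sub>R y) = c\<^sub>0 + c\<^sub>1 * t + c\<^sub>2 * t\<^sup>2"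
      using line[of 0 y] by auto
    have c0: "c\<^sub>0 = 0"
      using c[of 0] bound[of 0] by simp
    have b: "\<bar>c\<^sub>1 * t + c\<^sub>2 * t\<^sup>2\<bar> \<le> t\<^sup>2 * (norm y)\<^sup>2" for t
      using bound[of "t *\<^sub>R y"] c[of t] c0 by (simp add: power_mult_distrib)
    have "c\<^sub>1 = 0"
    proof (rule ccontr)
      assume c1: "c\<^sub>1 \<noteq> 0"
      \<comment> \<open>For t > 0 the growth bound implies |c1| \<le> t (|y|^2 + |c2|). With
        \<open>M\<close> exceeding the bracket by 1, this fails at t = |c1| / M.\<close>
      define M where "M = (norm y)\<^sup>2 + \<bar>c\<^sub>2\<bar> + 1"
      have M: "M > 0"
        by (simp add: M_def add_nonneg_pos)
      define t where "t = \<bar>c\<^sub>1\<bar> / M"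
      have t: "t > 0" "t * M = \<bar>c\<^sub>1\<bar>"
        using c1 M by (simp_all add: t_def)
      have "\<bar>c\<^sub>1 * t\<bar> \<le> \<bar>c\<^sub>1 * t + c\<^sub>2 * t\<^sup>2\<bar> + \<bar>c\<^sub>2 * t\<^sup>2\<bar>"
        by linarith
      also have "\<dots> \<le> t\<^sup>2 * (norm y)\<^sup>2 + \<bar>c\<^sub>2\<bar> * t\<^sup>2"
        using b[of t] by (simp add: abs_mult)
      also have "\<dots> = t * (t * (M - 1))"
        by (simp add: M_def power2_eq_square algebra_simps)
      finally have "t * \<bar>c\<^sub>1\<bar> \<le> t * (t * (M - 1))"
        using t by (simp add: abs_mult mult.commute)
      then have "\<bar>c\<^sub>1\<bar> \<le> t * (M - 1)"
        using t(1) by simp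
      then show False
        using t by (simp add: algebra_simps)
    qed
    then show ?thesis
      using c[of t] c[of 1] c0 by simp
  qed
  have expand: "\<exists>c. \<forall>t. q (x + t *\<^sub>R y) = q x + c * t + q y * t\<^sup>2" for x y
  proof -
    obtain c\<^sub>0 c\<^sub>1 c\<^sub>2 where c: "\<And>t. q (x + t *\<^sub>R y) = c\<^sub>0 + c\<^sub>1 * t + c\<^sub>2 * t\<^sup>2"
      using line by blast
    obtain d\<^sub>0 d\<^sub>1 d\<^sub>2 where d: "\<And>t. q (y + t *\<^sub>R x) = d\<^sub>0 + d\<^sub>1 * t + d\<^sub>2 * t\<^sup>2"
      using line by blast
    have c0: "c\<^sub>0 = q x" and d0: "d\<^sub>0 = q y"
      using c[of 0] d[of 0] by simp_all
    \<comment> \<open>The line through \<open>x\<close> in direction \<open>y\<close> is, by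
      homogeneity, also seen from \<open>y\<close> in direction \<open>x\<close>. Comparing the two
      expansions at t = 1, -1, 2 identifies the coefficient of t^2 with \<open>q y\<close>.\<close>
    have eq: "c\<^sub>0 + c\<^sub>1 * t + c\<^sub>2 * t\<^sup>2 = t\<^sup>2 * (d\<^sub>0 + d\<^sub>1 / t + d\<^sub>2 / t\<^sup>2)" if "t \<noteq> 0" for t
    proof -
      have "x + t *\<^sub>R y = t *\<^sub>R (y + (1 / t) *\<^sub>R x)"
        using that by (simp add: scaleR_add_right)
      then show ?thesis
        using c[of t] d[of "1 / t"] hom by (simp add: power_one_over)
    qed
    have "c\<^sub>2 = d\<^sub>0"
      using eq[of 1] eq[of "- 1"] eq[of 2] by (simp add: power2_eq_square)
    then show ?thesis
      using c c0 d0 by blast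
  qed
  have par: "q (x + y) + q (x - y) = 2 * q x + 2 * q y" for x y
  proof -
    obtain c where "\<And>t. q (x + t *\<^sub>R y) = q x + c * t + q y * t\<^sup>2"
      using expand by blast
    from this[of 1] this[of "- 1"] show ?thesis
      by simp
  qed
  have scale: "polar q x (t *\<^sub>R y) = t * polar q x y" for t x y
  proof -
    obtain c where "\<And>t. q (x + t *\<^sub>R y) = q x + c * t + q y * t\<^sup>2"
      using expand by blast
    from this[of 1] this[of t] show ?thesis
      by (simp add: polar_def hom mult.commute)
  qed
  have diff: "polar q x y = (q (x + y) - q (x - y)) / 4" for x y
    using par[of x y] by (simp add: polar_def)
  have "polar q (x + z) y + polar q (x - z) y = 2 * polar q x y" for x y z
  proof -
    have "polar q (x + z) y = (q (x + y + z) - q (x - y + z)) / 4"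
      "polar q (x - z) y = (q (x + y - z) - q (x - y - z)) / 4"
      by (simp_all add: diff algebra_simps)
    then show ?thesis
      using par[of "x + y" z] par[of "x - y" z] diff[of x y] by simp
  qed
  then have mid: "polar q y (x + z) + polar q y (x - z) = 2 * polar q y x" for x y z
    by (metis polar_commute)
  have "polar q y (u + v) = polar q y u + polar q y v" for u v y
  proof -
    have half: "(1/2) *\<^sub>R (a + a) = a" for a :: 'a
      by (rule scaleR_half_double)
    \<comment> \<open>In the midpoint identity \<open>mid\<close>, the half sum and the half
      difference of \<open>u\<close> and \<open>v\<close> produce \<open>u\<close> and
      \<open>v\<close> themselves, and homogeneity removes the factor 1/2.\<close>
    have uv: "(1/2) *\<^sub>R (u + v) + (1/2) *\<^sub>R (u - v) = u" "(1/2) *\<^sub>R (u + v) - (1/2) *\<^sub>R (u - v) = v"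
      unfolding scaleR_add_right[symmetric] scaleR_diff_right[symmetric]
      using half[of u] half[of v] by (simp_all add: algebra_simps)
    show ?thesis
      using mid[of y "(1/2) *\<^sub>R (u + v)" "(1/2) *\<^sub>R (u - v)"] unfolding uv scale by simp
  qed
  then have lin: "linear (polar q y)" for y
    using scale by (intro linearI) auto
  have "bilinear (polar q)"
    unfolding bilinear_def using lin by (auto simp: polar_commute[of q _ "_::'a"])
  moreover have "polar q x x = q x" for x
    using hom[of 2 x] by (simp add: polar_def scaleR_2)
  ultimately show ?thesis
    by (simp add: quadratic_form_def)
qed

lemma sum_fun_apply: "(\<Sum>i\<in>I. f i) x = (\<Sum>i\<in>I. f i x)"
  by (induction I rule: infinite_finite_induct) auto

text \<open>Evaluating a linear relation at \<open>p j\<close> isolates the coefficient of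
  \<open>f j\<close>.\<close>

lemma dim_eq_card_if_dual_points:
  fixes f :: "'i \<Rightarrow> 'a \<Rightarrow> real"
  assumes I: "finite I" and c: "c \<noteq> 0"
    and dual: "\<And>i j. i \<in> I \<Longrightarrow> j \<in> I \<Longrightarrow> f i (p j) = (if i = j then c else 0)"
  shows "fun_space.dim (f ` I) = card I"
proof -
  have inj: "inj_on f I"
    using dual c by (metis (mono_tags, lifting) inj_onI)
  have "\<not> fun_space.dependent (f ` I)"
  proof
    assume "fun_space.dependent (f ` I)"
    then obtain u where u: "\<exists>v\<in>f ` I. u v \<noteq> 0" "(\<Sum>v\<in>f ` I. (\<lambda>x. u v * v x)) = 0"
      using I by (auto simp: fun_space.dependent_finite)
    have "u (f j) = 0" if j: "j \<in> I" for j
    proof -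
      have "0 = (\<Sum>v\<in>f ` I. (\<lambda>x. u v * v x)) (p j)"
        using u(2) by simp
      also have "\<dots> = (\<Sum>i\<in>I. u (f i) * f i (p j))"
        using sum.reindex[OF inj] by (simp add: sum_fun_apply)
      also have "\<dots> = (\<Sum>i\<in>I. if i = j then u (f i) * c else 0)"
        using dual j by (intro sum.cong) auto
      also have "\<dots> = u (f j) * c"
        using I j by simp
      finally show ?thesis
        using c by simp
    qed
    then show False
      using u(1) by auto
  qed
  then show ?thesis
    using fun_space.dim_eq_card_independent card_image[OF inj] by metis
qed

text \<open>A sum of squares does not change under an orthogonal transformation of the list of
  summands. A list longer than \<open>card A\<close> satisfies a linear relation; the reflection
  that carries its coefficient vector to a coordinate axis makes the summand on that axis
  vanish.\<close>

lemma sum_squares_reduce: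
  fixes A :: "('a \<Rightarrow> real) set"
  assumes A: "finite A"
  shows "set ps \<subseteq> fun_space.span A \<Longrightarrow>
    \<exists>qs. length qs \<le> card A \<and> set qs \<subseteq> fun_space.span A \<and>
      (\<forall>x. (\<Sum>q\<leftarrow>qs. (q x)\<^sup>2) = (\<Sum>q\<leftarrow>ps. (q x)\<^sup>2))"
proof (induction "length ps" arbitrary: ps rule: less_induct)
  case less
  define n where "n = length ps"
  show ?case
  proof (cases "n \<le> card A")
    case True
    then show ?thesis
      using less.prems n_def by blast
  next
    case False
    have "(!) ps ` {..<n} \<subseteq> fun_space.span A"
      using less.prems by (auto simp: n_def)
    then obtain u k where k: "k < n" "u k \<noteq> 0" and u: "(\<Sum>i<n. (\<lambda>x. u i * (ps ! i) x)) = 0"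
      using fun_space.exists_relation[of "{..<n}" A "(!) ps"] A False by auto
    define I where "I = {..<n} - {k}"
    define c where "c = u k"
    define s where "s = (\<Sum>i\<in>I. (u i)\<^sup>2)"
    \<comment> \<open>\<open>e\<close> is the entry at position \<open>k\<close> of the Householder
      vector obtained from \<open>u\<close> by adding \<open>sgn c\<close> times the norm of
      \<open>u\<close> in that position. The sign keeps \<open>e\<close> away from 0. Modulo the
      relation the reflection acts by \<open>r\<close> below, and
      \<open>t\<^sup>2 * s - 2 * t * c = 1\<close> says that the other entries absorb the square of
      the deleted one.\<close>
    define e where "e = c + sgn c * sqrt (c\<^sup>2 + s)"
    define t where "t = - 1 / e"
    have s: "s \<ge> 0"
      by (simp add: s_def sum_nonneg)
    have c: "c \<noteq> 0"
      using k by (simp add: c_def)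
    have "e * sgn c > 0"
      using c s by (simp add: e_def algebra_simps sgn_if add_pos_nonneg)
    then have e: "e \<noteq> 0"
      by auto
    have "(sgn c)\<^sup>2 = 1"
      using c by (simp add: sgn_if)
    then have "e\<^sup>2 = 2 * c * e + s"
      using s by (simp add: e_def power2_sum power_mult_distrib algebra_simps power2_eq_square)
    then have t: "t\<^sup>2 * s - 2 * t * c = 1"
    proof -
      have "t\<^sup>2 * s - 2 * t * c = (2 * c * e + s) / e\<^sup>2"
        using e by (simp add: t_def power2_eq_square add_divide_distrib)
      then show ?thesis
        using e \<open>e\<^sup>2 = 2 * c * e + s\<close> by (metis divide_self_if power_eq_0_iff)
    qed
    have rel: "(\<Sum>i\<in>I. u i * (ps ! i) x) = - c * (ps ! k) x" for x
    proof -
      have "0 = (\<Sum>i<n. u i * (ps ! i) x)"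
        using fun_cong[OF u, of x] by (simp add: sum_fun_apply)
      also have "\<dots> = c * (ps ! k) x + (\<Sum>i\<in>I. u i * (ps ! i) x)"
        using k by (simp add: I_def c_def sum.remove)
      finally show ?thesis
        by simp
    qed
    define r where "r = (\<lambda>i x. (ps ! i) x + t * u i * (ps ! k) x)"
    define rs where "rs = map r (filter (\<lambda>i. i \<noteq> k) [0..<n])"
    have "length (filter (\<lambda>i. i \<noteq> k) [0..<n]) < length [0..<n]"
      using k by (intro length_filter_less[of k]) auto
    then have len: "length rs < length ps"
      by (simp add: rs_def n_def)
    have span: "set rs \<subseteq> fun_space.span A"
    proof
      fix f assume "f \<in> set rs"
      then obtain i where i: "i < n" "f = ps ! i + (\<lambda>x. (t * u i) * (ps ! k) x)"
        by (auto simp: rs_def r_def fun_eq_iff)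
      moreover have "ps ! i \<in> fun_space.span A" "ps ! k \<in> fun_space.span A"
        using i k less.prems by (auto simp: n_def)
      ultimately show "f \<in> fun_space.span A"
        using fun_space.span_add fun_space.span_scale by blast
    qed
    have sum: "(\<Sum>q\<leftarrow>rs. (q x)\<^sup>2) = (\<Sum>q\<leftarrow>ps. (q x)\<^sup>2)" for x
    proof -
      define y where "y = (ps ! k) x"
      have "(\<Sum>q\<leftarrow>rs. (q x)\<^sup>2) = (\<Sum>i\<in>I. (r i x)\<^sup>2)"
        unfolding rs_def map_map
        by (subst sum_list_distinct_conv_sum_set) (auto intro!: sum.cong simp: I_def)
      also have "\<dots> = (\<Sum>i\<in>I. ((ps ! i) x)\<^sup>2 + (2 * t * y) * (u i * (ps ! i) x) + t\<^sup>2 * y\<^sup>2 * (u i)\<^sup>2)"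
        by (intro sum.cong refl) (simp add: r_def y_def power2_eq_square algebra_simps)
      also have "\<dots> = (\<Sum>i\<in>I. ((ps ! i) x)\<^sup>2) + y\<^sup>2 * (t\<^sup>2 * s - 2 * t * c)"
        unfolding sum.distrib sum_distrib_left[symmetric] rel s_def[symmetric]
        by (simp add: y_def[symmetric] algebra_simps power2_eq_square)
      also have "\<dots> = (\<Sum>i<n. ((ps ! i) x)\<^sup>2)"
        using k by (simp add: t y_def I_def sum.remove)
      also have "\<dots> = (\<Sum>q\<leftarrow>ps. (q x)\<^sup>2)"
        by (simp add: sum_list_sum_nth n_def atLeast0LessThan)
      finally show ?thesis .
    qed
    show ?thesis
      using less.hyps[OF len span] sum by auto
  qed
qed

lemma real_polynomial_function_span:
  assumes "\<forall>q\<in>A. real_polynomial_function q" "f \<in> fun_space.span A"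
  shows "real_polynomial_function f"
proof -
  have "fun_space.span A \<subseteq> {q. real_polynomial_function q}"
  proof (rule fun_space.span_minimal)
    show "fun_space.subspace {q::'a \<Rightarrow> real. real_polynomial_function q}"
      by (rule fun_space.subspaceI)
        (auto simp: plus_fun_def zero_fun_def intro: real_polynomial_function.intros)
  qed (use assms in auto)
  then show ?thesis
    using assms by blast
qed

lemma sos_rank_basis:
  obtains B where "B \<subseteq> set ps" "\<not> fun_space.dependent B" "set ps \<subseteq> fun_space.span B"
    "finite B" "card B = sos_rank ps" "fun_space.span B = fun_space.span (set ps)"
proof -
  obtain B where B: "B \<subseteq> set ps" "\<not> fun_space.dependent B" "set ps \<subseteq> fun_space.span B"
    "card B = fun_space.dim (set ps)"
    using fun_space.basis_exists[of "set ps"] .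
  show thesis
  proof (rule that)
    show "card B = sos_rank ps"
      using B(4) by (simp add: sos_rank_def)
    show "finite B"
      using B(1) finite_subset by blast
    show "fun_space.span B = fun_space.span (set ps)"
      using B by (metis fun_space.span_eq fun_space.span_mono fun_space.span_span order_antisym)
  qed (use B in auto)
qed

lemma sos_rank_le_card:
  assumes "set ps \<subseteq> fun_space.span A" "finite A"
  shows "sos_rank ps \<le> card A"
  unfolding sos_rank_def fun_space.dim_span using fun_space.dim_le_card[OF assms] .

text \<open>A representation may have more summands than its rank. This shortening is what makes the
  frame irredundant in the case of equality.\<close>

lemma sos_representation_reduce:
  assumes "sos_representation p ps"
  obtains qs where "sos_representation p qs" "length qs \<le> sos_rank ps"
proof -
  obtain B where B: "set ps \<subseteq> fun_space.span B" "finite B" "card B = sos_rank ps"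
    "fun_space.span B = fun_space.span (set ps)"
    using sos_rank_basis .
  obtain qs where qs: "length qs \<le> card B" "set qs \<subseteq> fun_space.span B"
      "\<forall>x. (\<Sum>q\<leftarrow>qs. (q x)\<^sup>2) = (\<Sum>q\<leftarrow>ps. (q x)\<^sup>2)"
    using sum_squares_reduce[OF B(2,1)] by blast
  have "sos_representation p qs"
    using assms qs real_polynomial_function_span[of "set ps"] B(4)
    unfolding sos_representation_def by auto
  then show thesis
    using that qs(1) B(3) by simp
qed

lemma sos_summand_bound:
  fixes p :: "'a::real_normed_vector \<Rightarrow> real"
  assumes "sos_representation p ps" "q \<in> set ps"
  shows "(q x)\<^sup>2 \<le> p x"
proof -
  have "0 \<le> (\<Sum>q\<leftarrow>ps. (q x)\<^sup>2)"
    for ps :: "('a \<Rightarrow> real) list"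
    by (induction ps) auto
  then have "(q x)\<^sup>2 \<le> (\<Sum>q\<leftarrow>ps. (q x)\<^sup>2)"
    using assms(2) by (induction ps) (auto intro: add_increasing)
  then show ?thesis
    using assms(1) by (simp add: sos_representation_def)
qed

text \<open>The bound by \<open>p\<close> is available for the summands only; linear combinations
  inherit the conclusion because quadratic forms are a subspace.\<close>

lemma sos_span_quadratic_form:
  assumes ps: "sos_representation p ps" and p: "\<And>x. p x \<le> norm x ^ 4"
    and f: "f \<in> fun_space.span (set ps)"
  shows "quadratic_form f"
proof -
  have "quadratic_form q" if q: "q \<in> set ps" for q
  proof (rule quadratic_form_if_quadratic_growth)
    show "real_polynomial_function q"
      using ps q by (simp add: sos_representation_def)
    fix v
    have "(q v)\<^sup>2 \<le> ((norm v)\<^sup>2)\<^sup>2"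
      using sos_summand_bound[OF ps q, of v] p[of v] by simp
    then show "\<bar>q v\<bar> \<le> (norm v)\<^sup>2"
      by (subst (asm) power2_le_iff_abs_le) auto
  qed
  then have "fun_space.span (set ps) \<subseteq> {q. quadratic_form q}"
    by (intro fun_space.span_minimal subspace_quadratic_form) auto
  then show ?thesis
    using f by blast
qed

section \<open>Clifford systems and the Hurwitz condition\<close>

text \<open>Operators on an arbitrary Euclidean space take the place of matrices, since the system
  will be extended by operators of quadratic forms and also cut down to its first four
  members.\<close>

locale clifford_operators =
  fixes m :: nat and C :: "nat \<Rightarrow> 'a::euclidean_space \<Rightarrow> 'a"
  assumes linear_C: "\<alpha> \<le> m \<Longrightarrow> linear (C \<alpha>)"
    and adjoint_C: "\<alpha> \<le> m \<Longrightarrow> C \<alpha> x \<bullet> y = x \<bullet> C \<alpha> y"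
    and involution_C: "\<alpha> \<le> m \<Longrightarrow> C \<alpha> (C \<alpha> x) = x"
    and anticommute_C: "\<alpha> \<le> m \<Longrightarrow> \<beta> \<le> m \<Longrightarrow> \<alpha> \<noteq> \<beta> \<Longrightarrow> C \<alpha> (C \<beta> x) = - C \<beta> (C \<alpha> x)"
begin

lemma C_minus: "\<alpha> \<le> m \<Longrightarrow> C \<alpha> (- x) = - C \<alpha> x"
  by (simp add: linear_C linear_neg)

lemma C_add: "\<alpha> \<le> m \<Longrightarrow> C \<alpha> (x + y) = C \<alpha> x + C \<alpha> y"
  by (simp add: linear_C linear_add)

lemma C_diff: "\<alpha> \<le> m \<Longrightarrow> C \<alpha> (x - y) = C \<alpha> x - C \<alpha> y"
  by (simp add: linear_C linear_diff)

lemma isometry_C: "\<alpha> \<le> m \<Longrightarrow> C \<alpha> x \<bullet> C \<alpha> y = x \<bullet> y"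
  by (simp add: adjoint_C involution_C)

text \<open>The product of two anticommuting symmetric operators is skew.\<close>

lemma orthogonal_C:
  assumes "\<alpha> \<le> m" "\<beta> \<le> m" "\<alpha> \<noteq> \<beta>"
  shows "C \<alpha> x \<bullet> C \<beta> x = 0"
proof -
  have "C \<alpha> x \<bullet> C \<beta> x = - (C \<beta> x \<bullet> C \<alpha> x)"
    using assms anticommute_C[OF assms, of x] by (simp add: adjoint_C)
  then show ?thesis
    by (simp add: inner_commute)
qed

definition plus_space :: "'a set" where "plus_space = {x. C 0 x = x}"
definition minus_space :: "'a set" where "minus_space = {x. C 0 x = - x}"

lemma subspace_plus: "subspace plus_space"
  using subspace_eigenspace[OF subspace_UNIV linear_C[of 0], of 1] by (simp add: plus_space_def)

lemma subspace_minus: "subspace minus_space"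
  using subspace_eigenspace[OF subspace_UNIV linear_C[of 0], of "- 1"] by (simp add: minus_space_def)

lemma C_plus_minus: "1 \<le> \<alpha> \<Longrightarrow> \<alpha> \<le> m \<Longrightarrow> x \<in> plus_space \<Longrightarrow> C \<alpha> x \<in> minus_space"
  using anticommute_C[of 0 \<alpha> x] by (simp add: plus_space_def minus_space_def)

lemma C_minus_plus: "1 \<le> \<alpha> \<Longrightarrow> \<alpha> \<le> m \<Longrightarrow> x \<in> minus_space \<Longrightarrow> C \<alpha> x \<in> plus_space"
  using anticommute_C[of 0 \<alpha> x] by (simp add: plus_space_def minus_space_def C_minus)

lemma plus_minus_orthogonal:
  assumes "x \<in> plus_space" "y \<in> minus_space"
  shows "x \<bullet> y = 0" "y \<bullet> x = 0"
proof -
  have "x \<bullet> y = - (x \<bullet> y)"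
    using adjoint_C[of 0 x y] assms by (simp add: plus_space_def minus_space_def)
  then show "x \<bullet> y = 0" "y \<bullet> x = 0"
    by (simp_all add: inner_commute)
qed

lemma plus_minus_decomposition:
  obtains y z where "y \<in> plus_space" "z \<in> minus_space" "x = y + z"
proof
  show "(1/2) *\<^sub>R (x + C 0 x) \<in> plus_space" "(1/2) *\<^sub>R (x - C 0 x) \<in> minus_space"
    by (simp_all add: plus_space_def minus_space_def linear_scale linear_C C_add C_diff
        involution_C algebra_simps)
  have "(1/2) *\<^sub>R (x + C 0 x) + (1/2) *\<^sub>R (x - C 0 x) = (1/2 + 1/2) *\<^sub>R x"
    unfolding scaleR_left_distrib by (simp add: scaleR_right_distrib scaleR_right_diff_distrib)
  then show "x = (1/2) *\<^sub>R (x + C 0 x) + (1/2) *\<^sub>R (x - C 0 x)"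
    by simp
qed

lemma dim_eigenspaces:
  assumes "1 \<le> m" "DIM('a) = 2 * l"
  shows "dim plus_space = l" "dim minus_space = l"
  using dim_anticommuting_involutions[OF subspace_UNIV linear_C[of 0] _ _ linear_C[of 1]] assms
    involution_C anticommute_C[of 0 1]
  by (simp_all add: plus_space_def minus_space_def)

end

text \<open>The operator \<open>C\<^sub>0C\<^sub>1\<close> is a complex structure, and the products \<open>C\<^sub>0C\<^sub>1C\<^bsub>2j\<^esub>C\<^bsub>2j+1\<^esub>\<close> are commuting
  involutions commuting with it. Each of them halves the common fixed space of the previous ones, and
  the last fixed space still has even dimension.\<close>

lemma (in clifford_operators) fixed_space_dim:
  assumes k: "2 * k + 1 \<le> m"
  defines "S \<equiv> \<lambda>k. {x. \<forall>j\<in>{1..k}. C 0 (C 1 (C (2 * j) (C (2 * j + 1) x))) = x}"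
  shows "DIM('a) = 2 ^ k * dim (S k) \<and> subspace (S k)"
  using k
proof (induction k)
  case 0
  then show ?case
    by (simp add: S_def)
next
  case (Suc k)
  let ?T = "\<lambda>j x. C 0 (C 1 (C (2 * j) (C (2 * j + 1) x)))"
  have IH: "DIM('a) = 2 ^ k * dim (S k)" "subspace (S k)"
    using Suc by simp_all
  have linT: "linear (?T j)" if "j \<le> Suc k" for j
  proof -
    have "linear (C 0 \<circ> (C 1 \<circ> (C (2 * j) \<circ> C (2 * j + 1))))"
      using Suc.prems that by (intro linear_compose linear_C) auto
    then show ?thesis
      by (simp add: o_def)
  qed
  \<comment> \<open>Used as a rewrite rule, anticommutation sorts a product of generators by index,
    so the sign computations below become normalizations.\<close>
  have sort: "C \<beta> (C \<alpha> x) = - C \<alpha> (C \<beta> x)" if "\<alpha> < \<beta>" "\<beta> \<le> m" for \<alpha> \<beta> x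
    using anticommute_C[of \<beta> \<alpha> x] that by simp
  have comm: "?T i (?T j x) = ?T j (?T i x)" if "i < j" "1 \<le> i" "j \<le> Suc k" for i j x
    using that Suc.prems by (simp add: sort C_minus involution_C)
  have inv: "?T j (?T j x) = x" if "1 \<le> j" "j \<le> Suc k" for j x
    using that Suc.prems by (simp add: sort C_minus involution_C)
  \<comment> \<open>\<open>C (2 * Suc k)\<close> commutes with a product of four other generators,
    but anticommutes with the product that contains it, where it passes only three others.\<close>
  have A1: "?T j (C (2 * Suc k) x) = C (2 * Suc k) (?T j x)" if "1 \<le> j" "j \<le> k" for j x
    using that Suc.prems by (simp add: sort C_minus involution_C)
  have A2: "?T (Suc k) (C (2 * Suc k) x) = - C (2 * Suc k) (?T (Suc k) x)" for x
    using Suc.prems by (simp add: sort C_minus involution_C)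
  have S_Suc: "S (Suc k) = {x \<in> S k. ?T (Suc k) x = x}"
    unfolding S_def by (subst atLeastAtMostSuc_conv) auto
  have fixed: "?T j x = x" if "x \<in> S k" "j \<in> {1..k}" for x j
    using that by (simp add: S_def)
  have "?T (Suc k) x \<in> S k" if "x \<in> S k" for x
  proof -
    have "?T j (?T (Suc k) x) = ?T (Suc k) x" if "j \<in> {1..k}" for j
      using comm[of j "Suc k" x] fixed[OF \<open>x \<in> S k\<close> that] that by simp
    then show ?thesis
      by (simp add: S_def)
  qed
  then have "?T (Suc k) ` S k \<subseteq> S k"
    by blast
  moreover have "C (2 * Suc k) x \<in> S k" if "x \<in> S k" for x
  proof -
    have "?T j (C (2 * Suc k) x) = C (2 * Suc k) x" if "j \<in> {1..k}" for j
      using A1[of j x] fixed[OF \<open>x \<in> S k\<close> that] that by simp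
    then show ?thesis
      by (simp add: S_def)
  qed
  then have "C (2 * Suc k) ` S k \<subseteq> S k"
    by blast
  moreover have "?T (Suc k) (?T (Suc k) x) = x" for x
    by (rule inv) auto
  ultimately have "dim (S k) = 2 * dim {x \<in> S k. ?T (Suc k) x = x}"
    using Suc.prems A2
    by (intro dim_anticommuting_involutions(2)[OF IH(2) linT, where A = "C (2 * Suc k)"] linear_C involution_C) auto
  then have "dim (S k) = 2 * dim (S (Suc k))"
    using S_Suc by simp
  moreover have "subspace (S (Suc k))"
    using subspace_eigenspace[OF IH(2) linT[of "Suc k"], of 1] by (simp add: S_Suc)
  ultimately show ?case
    using IH by simp
qed

text \<open>The \<open>k\<close> halvings and the even dimension of the last fixed space give
  \<open>m = 2 ^ k * n\<close>. As \<open>m \<le> 2 * k + 2\<close>, exponential against linear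
  growth bounds \<open>k\<close> by 3, and divisibility of \<open>m\<close> by \<open>2 ^ k\<close>
  selects 4 and 8.\<close>

theorem (in clifford_operators) hurwitz_condition:
  assumes dim: "DIM('a) = 2 * m" and m: "3 \<le> m"
  shows "m = 4 \<or> m = 8"
proof -
  \<comment> \<open>The number of disjoint pairs \<open>2 * j\<close>, \<open>2 * j + 1\<close>
    among the indices from 2 to \<open>m\<close>.\<close>
  define k where "k = (m - 1) div 2"
  define S where "S = {x. \<forall>j\<in>{1..k}. C 0 (C 1 (C (2 * j) (C (2 * j + 1) x))) = x}"
  have k: "2 * k + 1 \<le> m" "m \<le> 2 * k + 2"
    using m by (auto simp: k_def)
  have S: "DIM('a) = 2 ^ k * dim S" "subspace S"
    using fixed_space_dim[OF k(1)] by (simp_all add: S_def)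
  have sort: "C \<beta> (C \<alpha> x) = - C \<alpha> (C \<beta> x)" if "\<alpha> < \<beta>" "\<beta> \<le> m" for \<alpha> \<beta> x
    using anticommute_C[of \<beta> \<alpha> x] that by simp
  have "\<exists>n u. dim S = 2 * n \<and> u ` {..<n} \<subseteq> S \<and> orthonormal_family {..<n} u \<and>
      (\<forall>i<n. \<forall>j<n. u i \<bullet> C 0 (C 1 (u j)) = 0)"
  proof (rule complex_structure_basis[OF S(2)])
    show "linear (\<lambda>x. C 0 (C 1 x))"
      using m linear_compose[OF linear_C[of 1] linear_C[of 0]] by (simp add: o_def)
    show "(\<lambda>x. C 0 (C 1 x)) ` S \<subseteq> S"
    proof (intro image_subsetI)
      fix x assume x: "x \<in> S"
      have "C 0 (C 1 (C (2 * j) (C (2 * j + 1) (C 0 (C 1 x))))) =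
          C 0 (C 1 (C 0 (C 1 (C (2 * j) (C (2 * j + 1) x)))))" if "j \<in> {1..k}" for j
        using that k by (simp add: sort C_minus involution_C)
      then show "C 0 (C 1 x) \<in> S"
        using x by (simp add: S_def)
    qed
    show "C 0 (C 1 (C 0 (C 1 x))) = - x" for x
      using m by (simp add: sort C_minus involution_C)
    show "C 0 (C 1 x) \<bullet> y = - (x \<bullet> C 0 (C 1 y))" for x y
      using m by (simp add: adjoint_C sort)
  qed
  then obtain n where "dim S = 2 * n"
    by blast
  then have mn: "m = 2 ^ k * n"
    using S(1) dim by simp
  then have "n \<noteq> 0"
    using m by (cases n) auto
  then have le: "2 ^ k \<le> m"
    using mn by simp
  have "2 ^ k > 2 * k + 2" if "k \<ge> 4" for k :: nat
    using that by (induction k rule: dec_induct) auto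
  then have "k < 4"
    using le k by (meson leD le_trans not_le)
  then consider "k = 1" | "k = 2" | "k = 3"
    using k m by linarith
  then show ?thesis
  proof cases
    case 1
    then have "m = 2 * n" "m = 3 \<or> m = 4"
      using k m mn by auto
    then show ?thesis
      by presburger
  next
    case 2
    then have "m = 4 * n" "m = 5 \<or> m = 6"
      using k mn by auto
    then show ?thesis
      by presburger
  next
    case 3
    then have "m = 8 * n" "m = 7 \<or> m = 8"
      using k mn by auto
    then show ?thesis
      by presburger
  qed
qed

section \<open>Sums of squares representations\<close>

definition clifford_G :: "nat \<Rightarrow> (nat \<Rightarrow> 'a::euclidean_space \<Rightarrow> 'a) \<Rightarrow> 'a \<Rightarrow> real" where
  "clifford_G m C x = norm x ^ 4 - (\<Sum>\<alpha>\<le>m. (C \<alpha> x \<bullet> x)\<^sup>2)"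

definition form_operator :: "('a::euclidean_space \<Rightarrow> real) \<Rightarrow> 'a \<Rightarrow> 'a" where
  "form_operator q x = (\<Sum>e\<in>Basis. polar q x e *\<^sub>R e)"

lemma inner_form_operator:
  assumes "quadratic_form q"
  shows "form_operator q x \<bullet> y = polar q x y"
proof -
  have lin: "linear (polar q x)"
    using assms by (simp add: quadratic_form_def bilinear_def)
  have "polar q x y = polar q x (\<Sum>e\<in>Basis. (y \<bullet> e) *\<^sub>R e)"
    by (simp add: euclidean_representation)
  also have "\<dots> = (\<Sum>e\<in>Basis. (y \<bullet> e) * polar q x e)"
    using lin by (simp add: linear_sum linear_scale)
  also have "\<dots> = (\<Sum>e\<in>Basis. polar q x e * (e \<bullet> y))"
    by (simp add: inner_commute mult.commute)
  finally show ?thesis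
    by (simp add: form_operator_def inner_sum_left)
qed

lemma polar_fun_zero: "polar 0 x y = 0"
  by (simp add: polar_def)

lemma polar_fun_add: "polar (f + g) x y = polar f x y + polar g x y"
  by (simp add: polar_def add_divide_distrib[symmetric])

lemma polar_fun_scale: "polar (\<lambda>x. c * f x) x y = c * polar f x y"
  by (simp add: polar_def right_diff_distrib)

lemma polar_span_zero:
  assumes "\<And>q. q \<in> A \<Longrightarrow> polar q x y = 0" "f \<in> fun_space.span A"
  shows "polar f x y = 0"
proof -
  have "fun_space.span A \<subseteq> {q. polar q x y = 0}"
    by (intro fun_space.span_minimal fun_space.subspaceI)
      (use assms(1) in \<open>auto simp: polar_fun_zero polar_fun_add polar_fun_scale\<close>)
  then show ?thesis
    using assms(2) by blast
qed

lemma apply_span_zero: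
  assumes "\<And>q. q \<in> A \<Longrightarrow> q x = 0" "f \<in> fun_space.span A"
  shows "f x = 0"
proof -
  have "fun_space.span A \<subseteq> {q. q x = 0}"
    by (intro fun_space.span_minimal fun_space.subspaceI) (use assms(1) in auto)
  then show ?thesis
    using assms(2) by blast
qed

lemma quadratic_form_polar_simps:
  assumes "quadratic_form q"
  shows "polar q (x + y) z = polar q x z + polar q y z" "polar q z (x + y) = polar q z x + polar q z y"
    "polar q (x - y) z = polar q x z - polar q y z" "polar q z (x - y) = polar q z x - polar q z y"
    "polar q (- x) z = - polar q x z" "polar q z (- x) = - polar q z x"
    "polar q (c *\<^sub>R x) z = c * polar q x z" "polar q z (c *\<^sub>R x) = c * polar q z x"
    "polar q x x = q x"
  using assms unfolding quadratic_form_def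
  by (auto simp: bilinear_ladd bilinear_radd bilinear_lsub bilinear_rsub bilinear_lneg bilinear_rneg
      bilinear_lmul bilinear_rmul)

locale clifford_sos = clifford_operators m C for m and C :: "nat \<Rightarrow> 'a::euclidean_space \<Rightarrow> 'a" +
  fixes ps :: "('a \<Rightarrow> real) list"
  assumes sos: "sos_representation (clifford_G m C) ps"
    and m_pos: "1 \<le> m"
begin

lemma span_quadratic_form: "q \<in> fun_space.span (set ps) \<Longrightarrow> quadratic_form q"
  by (rule sos_span_quadratic_form[OF sos]) (auto simp: clifford_G_def sum_nonneg)

lemma summand_in_span: "q \<in> set ps \<Longrightarrow> q \<in> fun_space.span (set ps)"
  by (rule fun_space.span_base)

lemmas polar_simps = quadratic_form_polar_simps[OF span_quadratic_form]

text \<open>On an eigenvector of \<open>C \<alpha>\<close> the single term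
  \<open>(C \<alpha> x \<bullet> x)\<^sup>2\<close> already equals \<open>norm x ^ 4\<close>, which
  leaves nothing for the squares of the summands.\<close>

lemma span_vanishes_on_eigenvectors:
  assumes q: "q \<in> fun_space.span (set ps)" and \<alpha>: "\<alpha> \<le> m" and x: "C \<alpha> x = x \<or> C \<alpha> x = - x"
  shows "q x = 0"
proof (rule apply_span_zero[OF _ q])
  fix q assume "q \<in> set ps"
  then have "(q x)\<^sup>2 \<le> clifford_G m C x"
    by (rule sos_summand_bound[OF sos])
  moreover have "norm x ^ 4 = (C \<alpha> x \<bullet> x)\<^sup>2"
    using x by (auto simp: dot_square_norm)
  moreover have "(C \<alpha> x \<bullet> x)\<^sup>2 \<le> (\<Sum>\<alpha>\<le>m. (C \<alpha> x \<bullet> x)\<^sup>2)"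
    using \<alpha> by (intro member_le_sum) auto
  ultimately have "(q x)\<^sup>2 \<le> 0"
    unfolding clifford_G_def by linarith
  then show "q x = 0"
    by simp
qed

text \<open>Vanishing on an eigenspace polarizes. Applied to the eigenvectors
  \<open>x + C \<alpha> x\<close> and \<open>x - C \<alpha> x\<close>, and likewise for
  \<open>y\<close>, this gives two identities whose sum is the claim.\<close>

lemma polar_C_C:
  assumes q: "q \<in> fun_space.span (set ps)" and \<alpha>: "\<alpha> \<le> m"
  shows "polar q (C \<alpha> x) (C \<alpha> y) = - polar q x y"
proof -
  have "polar q u v = 0" if "C \<alpha> u = u \<and> C \<alpha> v = v \<or> C \<alpha> u = - u \<and> C \<alpha> v = - v" for u v
  proof -
    have "C \<alpha> (u + v) = u + v \<or> C \<alpha> (u + v) = - (u + v)"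
      using that \<alpha> by (auto simp: C_add)
    then show ?thesis
      using span_vanishes_on_eigenvectors[OF q \<alpha>] that by (auto simp: polar_def)
  qed
  then have "polar q (x + C \<alpha> x) (y + C \<alpha> y) = 0" "polar q (x - C \<alpha> x) (y - C \<alpha> y) = 0"
    using \<alpha> by (simp_all add: C_add C_diff involution_C add.commute)
  then show ?thesis
    by (simp add: polar_simps[OF q])
qed

lemma polar_C:
  assumes "q \<in> fun_space.span (set ps)" "\<alpha> \<le> m"
  shows "polar q (C \<alpha> x) y = - polar q x (C \<alpha> y)"
  using polar_C_C[OF assms, of x "C \<alpha> y"] assms by (simp add: involution_C)

lemma polar_same_sign:
  assumes "q \<in> fun_space.span (set ps)"
  shows "x \<in> plus_space \<Longrightarrow> y \<in> plus_space \<Longrightarrow> polar q x y = 0"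
    "x \<in> minus_space \<Longrightarrow> y \<in> minus_space \<Longrightarrow> polar q x y = 0"
  using polar_C[OF assms, of 0 x y] by (auto simp: plus_space_def minus_space_def polar_simps[OF assms])

lemma form_operator_C:
  assumes "q \<in> fun_space.span (set ps)" "\<alpha> \<le> m"
  shows "form_operator q (C \<alpha> x) = - C \<alpha> (form_operator q x)"
proof (rule vector_eq_rdot[THEN iffD1], intro allI)
  fix y
  show "form_operator q (C \<alpha> x) \<bullet> y = - C \<alpha> (form_operator q x) \<bullet> y"
    using assms by (simp add: adjoint_C inner_form_operator[OF span_quadratic_form] polar_C)
qed

lemma form_operator_plus_minus:
  assumes "q \<in> fun_space.span (set ps)" "x \<in> plus_space"
  shows "form_operator q x \<in> minus_space"
  using form_operator_C[OF assms(1), of 0 x] assms(2)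
  by (simp add: plus_space_def minus_space_def) (metis minus_minus)

lemma form_operator_orthogonal_C:
  assumes q: "q \<in> fun_space.span (set ps)" and "\<alpha> \<le> m"
  shows "form_operator q x \<bullet> C \<alpha> x = 0"
  using assms polar_C[OF q, of \<alpha> x x] by (simp add: inner_form_operator[OF span_quadratic_form] polar_commute)

text \<open>The summands vanish on the eigenspaces of \<open>C 0\<close>, which consist of zeros of the polynomial, so the
  representation at \<open>x + y\<close> only involves their mixed terms.\<close>

lemma sos_identity:
  assumes x: "x \<in> plus_space" and y: "y \<in> minus_space"
  shows "(x \<bullet> x) * (y \<bullet> y) = (\<Sum>\<alpha>=1..m. (C \<alpha> x \<bullet> y)\<^sup>2) + (\<Sum>q\<leftarrow>ps. (polar q x y)\<^sup>2)"
proof -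
  have q: "(q (x + y))\<^sup>2 = 4 * (polar q x y)\<^sup>2" if "q \<in> set ps" for q
    using span_vanishes_on_eigenvectors[OF summand_in_span[OF that], of 0] x y
    by (simp add: polar_def plus_space_def minus_space_def power2_eq_square)
  have C: "C \<alpha> (x + y) \<bullet> (x + y) = 2 * (C \<alpha> x \<bullet> y)" if "\<alpha> \<in> {1..m}" for \<alpha>
    using that plus_minus_orthogonal[OF x C_plus_minus[OF _ _ x, of \<alpha>]]
      plus_minus_orthogonal[OF C_minus_plus[OF _ _ y, of \<alpha>] y] adjoint_C[of \<alpha> y x]
    by (simp add: C_add inner_add_left inner_add_right inner_commute)
  have "{..m} = insert 0 {1..m}"
    by auto
  then have "(\<Sum>\<alpha>\<le>m. (C \<alpha> (x + y) \<bullet> (x + y))\<^sup>2) =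
      (C 0 (x + y) \<bullet> (x + y))\<^sup>2 + (\<Sum>\<alpha>=1..m. (C \<alpha> (x + y) \<bullet> (x + y))\<^sup>2)"
    by simp
  also have "(\<Sum>\<alpha>=1..m. (C \<alpha> (x + y) \<bullet> (x + y))\<^sup>2) = 4 * (\<Sum>\<alpha>=1..m. (C \<alpha> x \<bullet> y)\<^sup>2)"
    unfolding sum_distrib_left using C by (intro sum.cong) (auto simp: power_mult_distrib)
  also have "C 0 (x + y) \<bullet> (x + y) = x \<bullet> x - y \<bullet> y"
    using x y by (simp add: C_add plus_space_def minus_space_def algebra_simps inner_commute)
  finally have "clifford_G m C (x + y) =
      (x \<bullet> x + y \<bullet> y)\<^sup>2 - (x \<bullet> x - y \<bullet> y)\<^sup>2 - 4 * (\<Sum>\<alpha>=1..m. (C \<alpha> x \<bullet> y)\<^sup>2)"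
  proof -
    assume "(\<Sum>\<alpha>\<le>m. (C \<alpha> (x + y) \<bullet> (x + y))\<^sup>2) =
      (x \<bullet> x - y \<bullet> y)\<^sup>2 + 4 * (\<Sum>\<alpha>=1..m. (C \<alpha> x \<bullet> y)\<^sup>2)"
    moreover have "norm (x + y) ^ 4 = ((x + y) \<bullet> (x + y))\<^sup>2"
      by (simp add: dot_square_norm)
    moreover have "(x + y) \<bullet> (x + y) = x \<bullet> x + y \<bullet> y"
      using plus_minus_orthogonal[OF x y] by (simp add: inner_add_left inner_add_right)
    ultimately show ?thesis
      by (simp add: clifford_G_def)
  qed
  moreover have "clifford_G m C (x + y) = 4 * (\<Sum>q\<leftarrow>ps. (polar q x y)\<^sup>2)"
  proof -
    have "clifford_G m C (x + y) = (\<Sum>q\<leftarrow>ps. (q (x + y))\<^sup>2)"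
      using sos by (simp add: sos_representation_def)
    also have "\<dots> = (\<Sum>q\<leftarrow>ps. 4 * (polar q x y)\<^sup>2)"
      using q by (intro arg_cong[of _ _ sum_list] map_cong) auto
    finally show ?thesis
      by (simp add: sum_list_const_mult)
  qed
  ultimately show ?thesis
    by (simp add: power2_eq_square algebra_simps)
qed

text \<open>With a smaller rank, the vectors \<open>C \<alpha> x\<close> and the images of
  \<open>x\<close> under the operators of a basis of the span could not span the minus space. A
  vector orthogonal to all of them makes the right-hand side of \<open>sos_identity\<close> vanish,
  but not the left-hand side.\<close>

lemma rank_lower_bound:
  assumes dim: "DIM('a) = 2 * l"
  shows "l \<le> m + sos_rank ps"
proof (rule ccontr)
  assume less: "\<not> l \<le> m + sos_rank ps"
  obtain B where B: "B \<subseteq> set ps" "set ps \<subseteq> fun_space.span B" "finite B" "card B = sos_rank ps"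
    using sos_rank_basis .
  have "dim plus_space \<noteq> 0"
    using less dim_eigenspaces[OF m_pos dim] by simp
  then obtain x where x: "x \<in> plus_space" "x \<noteq> 0"
    unfolding dim_eq_0 by blast
  define F where "F = (\<lambda>\<alpha>. C \<alpha> x) ` {1..m} \<union> (\<lambda>q. form_operator q x) ` B"
  have "card F \<le> m + sos_rank ps"
    unfolding F_def using card_Un_le card_image_le[of "{1..m}" "\<lambda>\<alpha>. C \<alpha> x"]
      card_image_le[OF B(3), of "\<lambda>q. form_operator q x"] B(4)
    by (metis (no_types, lifting) add_mono card_atLeastAtMost diff_Suc_1 finite_atLeastAtMost order_trans)
  moreover have "finite F"
    using B(3) by (simp add: F_def)
  ultimately have "dim (span F) < dim minus_space"
    using less dim_eigenspaces[OF m_pos dim] dim_le_card'[of F] by simp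
  moreover have "F \<subseteq> minus_space"
    using B(1) x(1) C_plus_minus form_operator_plus_minus summand_in_span by (auto simp: F_def)
  then have "span F \<subseteq> minus_space"
    by (intro span_minimal subspace_minus)
  ultimately have "span F \<subset> span minus_space"
    unfolding span_eq_iff[THEN iffD2, OF subspace_minus] by (metis dim_span less_irrefl psubsetI)
  then obtain y where y: "y \<noteq> 0" "y \<in> span minus_space" "\<And>z. z \<in> span F \<Longrightarrow> orthogonal y z"
    using orthogonal_to_subspace_exists_gen by blast
  have y_minus: "y \<in> minus_space"
    using y(2) span_eq_iff[THEN iffD2, OF subspace_minus] by simp
  have orth: "z \<bullet> y = 0" if "z \<in> F" for z
    using y(3)[OF span_base[OF that]] by (simp add: orthogonal_def inner_commute)
  have "polar q x y = 0" if "q \<in> set ps" for q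
  proof (rule polar_span_zero)
    show "q \<in> fun_space.span B"
      using that B(2) by blast
    fix f assume f: "f \<in> B"
    then have "f \<in> fun_space.span (set ps)"
      using B(1) summand_in_span by blast
    then show "polar f x y = 0"
      using orth[of "form_operator f x"] f inner_form_operator[OF span_quadratic_form]
      by (auto simp: F_def)
  qed
  then have "(\<Sum>q\<leftarrow>ps. (polar q x y)\<^sup>2) = (\<Sum>q\<leftarrow>ps. 0)"
    by (intro arg_cong[of _ _ sum_list] map_cong) auto
  moreover have "(\<Sum>\<alpha>=1..m. (C \<alpha> x \<bullet> y)\<^sup>2) = 0"
    using orth by (intro sum.neutral) (auto simp: F_def)
  ultimately have "(x \<bullet> x) * (y \<bullet> y) = 0"
    using sos_identity[OF x(1) y_minus] by simp
  then show False
    using x y by simp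
qed

text \<open>If there are as few summands as the lower bound allows, then for every unit vector \<open>x\<close> of the
  plus space the vectors \<open>C \<alpha> x\<close> and \<open>Q x\<close> form a tight frame without redundancy, hence an
  orthonormal basis, of the minus space. So the operators \<open>Q\<close> of the summands extend the Clifford
  system.\<close>

lemma clifford_extension:
  assumes dim: "DIM('a) = 2 * l" and len: "m + length ps \<le> l"
  shows "clifford_operators (m + length ps)
    (\<lambda>\<alpha>. if \<alpha> \<le> m then C \<alpha> else form_operator (ps ! (\<alpha> - m - 1)))"
proof -
  define n where "n = length ps"
  define Q where "Q = (\<lambda>i. form_operator (ps ! i))"
  have mem: "ps ! i \<in> fun_space.span (set ps)" if "i < n" for i
    using that by (auto simp: n_def intro: summand_in_span)
  have inner_Q: "Q i x \<bullet> y = polar (ps ! i) x y" if "i < n" for i x y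
    unfolding Q_def by (rule inner_form_operator[OF span_quadratic_form[OF mem[OF that]]])
  have adj_Q: "Q i x \<bullet> y = x \<bullet> Q i y" if "i < n" for i x y
    using inner_Q[OF that] polar_commute by (metis inner_commute)
  have lin_Q: "linear (Q i)" if "i < n" for i
    using mem[OF that] by (intro linearI)
      (simp_all add: Q_def form_operator_def polar_simps scaleR_add_left sum.distrib scaleR_sum_right)
  have QC: "Q i (C \<alpha> x) = - C \<alpha> (Q i x)" if "i < n" "\<alpha> \<le> m" for i \<alpha> x
    unfolding Q_def using that mem form_operator_C by blast
  have Q_plus_minus: "Q i x \<in> minus_space" if "i < n" "x \<in> plus_space" for i x
    unfolding Q_def using that mem form_operator_plus_minus by blast
  \<comment> \<open>The minus space is reached from the plus space by \<open>C 1\<close>, which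
    commutes with \<open>Q i\<close> up to sign.\<close>
  have Q_minus_plus: "Q i x \<in> plus_space" if "i < n" "x \<in> minus_space" for i x
  proof -
    have "Q i (C 1 x) \<in> minus_space"
      using that m_pos by (intro Q_plus_minus C_minus_plus) auto
    then have "C 1 (- C 1 (Q i x)) \<in> plus_space"
      using m_pos QC[OF that(1)] by (intro C_minus_plus) auto
    then show ?thesis
      using m_pos subspace_neg[OF subspace_plus] by (simp add: C_minus involution_C) fastforce
  qed
  have unit: "Q i x \<bullet> Q j x = (if i = j then 1 else 0)"
    if x: "x \<in> plus_space" "x \<bullet> x = 1" and ij: "i < n" "j < n" for x i j
  proof -
    define w where "w = case_sum (\<lambda>\<alpha>. C \<alpha> x) (\<lambda>i. Q i x)"
    let ?I = "{1..m} <+> {..<n}"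
    have "orthonormal_family ?I w"
    proof (rule orthonormal_if_parseval_frame[OF _ subspace_minus])
      show "w ` ?I \<subseteq> minus_space"
        using x Q_plus_minus C_plus_minus by (auto simp: w_def)
      show "card ?I \<le> dim minus_space"
        using len dim_eigenspaces[OF m_pos dim] by (simp add: card_Plus n_def)
      fix y assume y: "y \<in> minus_space"
      have "(\<Sum>q\<leftarrow>ps. (polar q x y)\<^sup>2) = (\<Sum>i<n. (Q i x \<bullet> y)\<^sup>2)"
        using inner_Q by (simp add: sum_list_sum_nth n_def atLeast0LessThan)
      then show "y \<bullet> y = (\<Sum>i\<in>?I. (w i \<bullet> y)\<^sup>2)"
        using sos_identity[OF x(1) y] x(2) by (simp add: sum.Plus w_def)
    qed simp
    then have "w (Inr i) \<bullet> w (Inr j) = (if Inr i = (Inr j :: nat + nat) then 1 else 0)"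
      using ij unfolding orthonormal_family_def by blast
    then show ?thesis
      by (simp add: w_def)
  qed
  have plus: "Q i x \<bullet> Q j x = (if i = j then x \<bullet> x else 0)"
    if x: "x \<in> plus_space" and ij: "i < n" "j < n" for x i j
  proof (cases "x = 0")
    case True
    then show ?thesis
      using lin_Q ij by (simp add: linear_0)
  next
    case False
    define u where "u = x /\<^sub>R norm x"
    have "u \<in> plus_space" "u \<bullet> u = 1"
      using x False by (auto simp: u_def subspace_plus subspace_scale dot_square_norm power2_eq_square)
    moreover have xu: "norm x *\<^sub>R u = x"
      using False by (simp add: u_def)
    have "Q k x = norm x *\<^sub>R Q k u" if "k < n" for k
      using linear_scale[OF lin_Q[OF that], of "norm x" u] unfolding xu .
    then have "Q i x \<bullet> Q j x = norm x * (norm x * (Q i u \<bullet> Q j u))"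
      using ij by simp
    ultimately show ?thesis
      using unit[of u i j] ij by (simp add: dot_square_norm power2_eq_square)
  qed
  \<comment> \<open>The frame argument was made on the plus space; the isometry \<open>C 1\<close>
    carries its conclusion to the minus space.\<close>
  have minus: "Q i x \<bullet> Q j x = (if i = j then x \<bullet> x else 0)"
    if x: "x \<in> minus_space" and ij: "i < n" "j < n" for x i j
  proof -
    have "Q i x \<bullet> Q j x = Q i (C 1 x) \<bullet> Q j (C 1 x)"
      using QC ij m_pos by (simp add: isometry_C)
    also have "\<dots> = (if i = j then x \<bullet> x else 0)"
      using plus[OF C_minus_plus[OF _ m_pos x] ij] m_pos by (simp add: isometry_C)
    finally show ?thesis .
  qed
  have all: "Q i x \<bullet> Q j x = (if i = j then x \<bullet> x else 0)" if ij: "i < n" "j < n" for x i j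
  proof -
    obtain y z where yz: "y \<in> plus_space" "z \<in> minus_space" and x: "x = y + z"
      using plus_minus_decomposition .
    show ?thesis
      unfolding x using plus[OF yz(1) ij] minus[OF yz(2) ij] plus_minus_orthogonal[OF yz] ij
        plus_minus_orthogonal[OF Q_minus_plus[OF ij(1) yz(2)] Q_plus_minus[OF ij(2) yz(1)]]
        plus_minus_orthogonal[OF Q_minus_plus[OF ij(2) yz(2)] Q_plus_minus[OF ij(1) yz(1)]]
      by (simp add: linear_add lin_Q inner_add_left inner_add_right)
  qed
  \<comment> \<open>Since the \<open>Q i\<close> are symmetric, the polarized norm identities are
    the Clifford relations between them.\<close>
  have polarized: "Q i x \<bullet> Q j y + Q i y \<bullet> Q j x = (if i = j then 2 * (x \<bullet> y) else 0)"
    if ij: "i < n" "j < n" for x y i j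
    using all[OF ij, of "x + y"] all[OF ij, of x] all[OF ij, of y] ij
    by (simp add: linear_add lin_Q inner_add_left inner_add_right inner_commute split: if_splits)
  have inv_Q: "Q i (Q i x) = x" if "i < n" for i x
  proof (rule vector_eq_rdot[THEN iffD1], intro allI)
    fix y
    show "Q i (Q i x) \<bullet> y = x \<bullet> y"
      using polarized[OF that that, of x y] adj_Q[OF that, of "Q i x" y]
      by (simp add: inner_commute[of "Q i y" "Q i x"])
  qed
  have anti_Q: "Q i (Q j x) = - Q j (Q i x)" if "i < n" "j < n" "i \<noteq> j" for i j x
  proof (rule vector_eq_rdot[THEN iffD1], intro allI)
    fix y
    show "Q i (Q j x) \<bullet> y = - Q j (Q i x) \<bullet> y"
      using polarized[OF that(1,2), of x y] that adj_Q
      by (simp add: inner_commute[of "Q i y" "Q j x"])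
  qed
  have idx: "\<alpha> - m - 1 < n" if "\<alpha> \<le> m + n" "\<not> \<alpha> \<le> m" for \<alpha>
    using that by auto
  have "clifford_operators (m + n) (\<lambda>\<alpha>. if \<alpha> \<le> m then C \<alpha> else Q (\<alpha> - m - 1))"
  proof
    fix \<alpha> \<beta> x
    assume \<alpha>\<beta>: "\<alpha> \<le> m + n" "\<beta> \<le> m + n" "\<alpha> \<noteq> \<beta>"
    have "\<alpha> - m - 1 \<noteq> \<beta> - m - 1" if "\<not> \<alpha> \<le> m" "\<not> \<beta> \<le> m"
      using \<alpha>\<beta> that by linarith
    then show "(if \<alpha> \<le> m then C \<alpha> else Q (\<alpha> - m - 1)) ((if \<beta> \<le> m then C \<beta> else Q (\<beta> - m - 1)) x) =
      - (if \<beta> \<le> m then C \<beta> else Q (\<beta> - m - 1)) ((if \<alpha> \<le> m then C \<alpha> else Q (\<alpha> - m - 1)) x)"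
      using anti_Q[OF idx[OF \<alpha>\<beta>(1)] idx[OF \<alpha>\<beta>(2)], of x] QC[OF idx[OF \<alpha>\<beta>(1)], of \<beta> x]
        QC[OF idx[OF \<alpha>\<beta>(2)], of \<alpha> x] anticommute_C[of \<alpha> \<beta> x] \<alpha>\<beta>(3)
      by (cases "\<alpha> \<le> m"; cases "\<beta> \<le> m") (simp_all only: if_True if_False simp_thms minus_minus)
  qed (use idx in \<open>auto simp: C_add linear_add[OF lin_Q] linear_scale[OF linear_C]
      linear_scale[OF lin_Q] adjoint_C adj_Q involution_C inv_Q\<close>)
  then show ?thesis
    unfolding n_def Q_def .
qed

text \<open>The vectors \<open>C \<alpha> x\<close> are mutually orthogonal and orthogonal to every
  \<open>form_operator q x\<close>. By \<open>inj\<close>, the latter are independent for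
  independent \<open>q\<close>, so \<open>m + sos_rank ps\<close> independent vectors fit into the
  minus space.\<close>

lemma rank_upper_bound_if_injective:
  assumes dim: "DIM('a) = 2 * l" and x: "x \<in> plus_space" "x \<noteq> 0"
    and inj: "\<And>q. q \<in> fun_space.span (set ps) \<Longrightarrow> (\<And>y. y \<in> minus_space \<Longrightarrow> polar q x y = 0) \<Longrightarrow> q = 0"
  shows "m + sos_rank ps \<le> l"
proof (rule ccontr)
  assume less: "\<not> m + sos_rank ps \<le> l"
  obtain B where B: "B \<subseteq> set ps" "\<not> fun_space.dependent B" "finite B" "card B = sos_rank ps"
    using sos_rank_basis .
  have B_span: "q \<in> fun_space.span (set ps)" if "q \<in> B" for q
    using that B(1) summand_in_span by blast
  define w where "w = case_sum (\<lambda>\<alpha>. C \<alpha> x) (\<lambda>q. form_operator q x)"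
  let ?I = "{1..m} <+> B"
  obtain E where E: "finite E" "span E = minus_space" "card E = dim minus_space"
    using basis_subspace_exists[OF subspace_minus] .
  have "w ` ?I \<subseteq> span E"
    using x B_span form_operator_plus_minus C_plus_minus E(2) by (auto simp: w_def)
  moreover have "card E < card ?I"
    using less B E dim_eigenspaces[OF m_pos dim] by (simp add: card_Plus)
  ultimately obtain u where u: "\<exists>i\<in>?I. u i \<noteq> 0" "(\<Sum>i\<in>?I. u i *\<^sub>R w i) = 0"
    using exists_relation[of ?I E w] B(3) E(1) by auto
  have rel: "(\<Sum>\<alpha>=1..m. u (Inl \<alpha>) *\<^sub>R C \<alpha> x) + (\<Sum>q\<in>B. u (Inr q) *\<^sub>R form_operator q x) = 0"
    using u(2) B(3) by (simp add: sum.Plus w_def)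
  have uC: "u (Inl \<beta>) = 0" if \<beta>: "\<beta> \<in> {1..m}" for \<beta>
  proof -
    have "0 = ((\<Sum>\<alpha>=1..m. u (Inl \<alpha>) *\<^sub>R C \<alpha> x) + (\<Sum>q\<in>B. u (Inr q) *\<^sub>R form_operator q x)) \<bullet> C \<beta> x"
      using rel by simp
    also have "\<dots> = (\<Sum>\<alpha>=1..m. u (Inl \<alpha>) * (C \<alpha> x \<bullet> C \<beta> x))"
      using \<beta> B_span form_operator_orthogonal_C by (simp add: inner_add_left inner_sum_left)
    also have "\<dots> = (\<Sum>\<alpha>=1..m. if \<alpha> = \<beta> then u (Inl \<alpha>) * (x \<bullet> x) else 0)"
      using \<beta> orthogonal_C by (intro sum.cong) (auto simp: isometry_C)
    also have "\<dots> = u (Inl \<beta>) * (x \<bullet> x)"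
      using \<beta> by simp
    finally show ?thesis
      using x(2) by simp
  qed
  define q where "q = (\<Sum>q\<in>B. (\<lambda>x. u (Inr q) * q x))"
  have "q = 0"
  proof (rule inj)
    show "q \<in> fun_space.span (set ps)"
      unfolding q_def using B_span by (intro fun_space.span_sum fun_space.span_scale)
    fix y
    have "polar q x y = (\<Sum>q\<in>B. u (Inr q) * polar q x y)"
      by (simp add: q_def sum_fun_apply polar_def sum_subtractf sum_divide_distrib
          right_diff_distrib diff_divide_distrib)
    also have "\<dots> = (\<Sum>q\<in>B. u (Inr q) *\<^sub>R form_operator q x) \<bullet> y"
      using B_span by (simp add: inner_sum_left inner_form_operator span_quadratic_form)
    also have "\<dots> = 0"
      using rel uC by simp
    finally show "polar q x y = 0" .
  qed
  then have "\<forall>q\<in>B. u (Inr q) = 0"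
    using B(2,3) fun_space.dependent_finite[of B] unfolding q_def by auto
  then show False
    using u(1) uC by auto
qed

end

text \<open>For \<open>m = 3\<close> let \<open>\<kappa> = C\<^sub>1C\<^sub>2C\<^sub>3\<close>. Then \<open>R(e, f) = b(e, \<kappa> f)\<close> is a symmetric form on the plus space
  for each summand with polarization \<open>b\<close>, and the polarized representation forces
  \<open>R(x, x) + R(w, w) = 0\<close> for unit vectors \<open>x\<close>, \<open>w\<close> orthogonal over the quaternions
  spanned by \<open>C\<^sub>1C\<^sub>2\<close>, \<open>C\<^sub>1C\<^sub>3\<close>, \<open>C\<^sub>2C\<^sub>3\<close>.\<close>

lemma clifford_sos_3_injective:
  fixes C :: "nat \<Rightarrow> 'a::euclidean_space \<Rightarrow> 'a"
  assumes "clifford_sos 3 C ps"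
    and q: "q \<in> fun_space.span (set ps)"
    and x: "C 0 x = x" "x \<noteq> 0"
    and zero: "\<And>y. C 0 y = - y \<Longrightarrow> polar q x y = 0"
  shows "q = 0"
proof -
  interpret clifford_sos 3 C ps by fact
  \<comment> \<open>\<open>\<kappa>\<close> is an isometry exchanging the eigenspaces, with square
    -1.\<close>
  define \<kappa> where "\<kappa> = (\<lambda>x. C 1 (C 2 (C 3 x)))"
  \<comment> \<open>The kernel of the operator of \<open>q\<close> on the plus space; the aim is to
    show that it is everything. It is stable under the products
    \<open>C \<alpha> (C \<beta> e)\<close>, so its orthogonal complement \<open>Kp\<close> is even
    quaternionically orthogonal to it.\<close>
  define K where "K = {e \<in> plus_space. \<forall>y\<in>minus_space. polar q e y = 0}"
  have sort: "C \<beta> (C \<alpha> x) = - C \<alpha> (C \<beta> x)" if "\<alpha> < \<beta>" "\<beta> \<le> 3" for \<alpha> \<beta> x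
    using anticommute_C[of \<beta> \<alpha> x] that by simp
  have x_plus: "x \<in> plus_space"
    using x by (simp add: plus_space_def)
  have \<kappa>_minus: "\<kappa> e \<in> minus_space" if "e \<in> plus_space" for e
    unfolding \<kappa>_def using that by (intro C_plus_minus C_minus_plus) auto
  have \<kappa>_plus: "\<kappa> e \<in> plus_space" if "e \<in> minus_space" for e
    unfolding \<kappa>_def using that by (intro C_plus_minus C_minus_plus) auto
  have \<kappa>_\<kappa>: "\<kappa> (\<kappa> e) = - e" for e
    by (simp add: \<kappa>_def sort C_minus involution_C)
  have \<kappa>_isometry: "\<kappa> e \<bullet> \<kappa> f = e \<bullet> f" for e f
    by (simp add: \<kappa>_def isometry_C)
  \<comment> \<open>Moving three generators across the form gives three signs, and reversing their
    order gives a fourth.\<close>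
  have R_sym: "polar f v (\<kappa> w) = polar f w (\<kappa> v)" if "f \<in> fun_space.span (set ps)" for f v w
  proof -
    have "polar f v (\<kappa> w) = - polar f (C 3 (C 2 (C 1 v))) w"
      using polar_C[OF that] by (simp add: \<kappa>_def)
    then show ?thesis
      using that by (simp add: \<kappa>_def sort C_minus polar_simps polar_commute[of f w])
  qed
  have CC_plus: "C \<alpha> (C \<beta> e) \<in> plus_space" if "e \<in> plus_space" "\<alpha> \<in> {1..3}" "\<beta> \<in> {1..3}" for e \<alpha> \<beta>
    using that by (intro C_plus_minus C_minus_plus) auto
  have CC_minus: "C \<alpha> (C \<beta> e) \<in> minus_space" if "e \<in> minus_space" "\<alpha> \<in> {1..3}" "\<beta> \<in> {1..3}" for e \<alpha> \<beta>
    using that by (intro C_plus_minus C_minus_plus) auto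
  \<comment> \<open>\<open>C \<alpha>\<close> times \<open>\<kappa>\<close> is, up to sign, the
    product of the other two generators. Quaternionic orthogonality therefore removes all Clifford
    terms from \<open>sos_identity\<close>. It also covers e = f, because these products are
    skew.\<close>
  have identity: "(\<Sum>i<length ps. (polar (ps ! i) e (\<kappa> f))\<^sup>2) = (e \<bullet> e) * (f \<bullet> f)"
    if ef: "e \<in> plus_space" "f \<in> plus_space"
      and orth: "\<And>\<alpha> \<beta>. \<alpha> \<in> {1..3} \<Longrightarrow> \<beta> \<in> {1..3} \<Longrightarrow> \<alpha> \<noteq> \<beta> \<Longrightarrow> C \<alpha> (C \<beta> e) \<bullet> f = 0" for e f
  proof -
    have "{1..3} = {1, 2, 3::nat}"
      by auto
    then have "(\<Sum>\<alpha>=1..3. (C \<alpha> e \<bullet> \<kappa> f)\<^sup>2) = 0"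
      using orth[of 3 2] orth[of 3 1] orth[of 2 1] by (simp add: \<kappa>_def adjoint_C sort C_minus involution_C)
    moreover have "(\<Sum>i<length ps. (polar (ps ! i) e (\<kappa> f))\<^sup>2) = (\<Sum>q\<leftarrow>ps. (polar q e (\<kappa> f))\<^sup>2)"
      by (simp add: sum_list_sum_nth atLeast0LessThan)
    ultimately show ?thesis
      using sos_identity[OF ef(1) \<kappa>_minus[OF ef(2)]] by (simp add: \<kappa>_isometry)
  qed
  have "polar q 0 y = 0" for y
    using polar_simps(7)[OF q, of 0 0 y] by simp
  then have K: "subspace K"
    unfolding K_def using subspace_plus by (auto simp: subspace_def polar_simps[OF q])
  have K_CC: "C \<alpha> (C \<beta> e) \<in> K" if "e \<in> K" "\<alpha> \<in> {1..3}" "\<beta> \<in> {1..3}" for e \<alpha> \<beta>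
    using that CC_plus CC_minus polar_C[OF q] by (auto simp: K_def)
  have xK: "x \<in> K"
    using x_plus zero by (auto simp: K_def minus_space_def)
  define Kp where "Kp = {w \<in> plus_space. \<forall>e\<in>K. e \<bullet> w = 0}"
  have Kp_add: "v + w \<in> Kp" if "v \<in> Kp" "w \<in> Kp" for v w
    using that by (auto simp: Kp_def inner_add_right subspace_plus subspace_add)
  have decomp: "\<exists>e\<in>K. \<exists>w\<in>Kp. f = e + w" if f: "f \<in> plus_space" for f
  proof -
    obtain e w where ew: "e \<in> span K" "\<And>v. v \<in> span K \<Longrightarrow> orthogonal w v" "f = e + w"
      using orthogonal_subspace_decomp_exists[of K f] by blast
    have eK: "e \<in> K"
      using ew(1) span_eq_iff[THEN iffD2, OF K] by simp
    moreover have "w \<in> plus_space"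
      using subspace_diff[OF subspace_plus f, of e] eK ew(3) by (simp add: K_def)
    moreover have "v \<bullet> w = 0" if "v \<in> K" for v
      using ew(2)[OF span_base[OF that]] by (simp add: orthogonal_def inner_commute)
    ultimately have "w \<in> Kp"
      by (simp add: Kp_def)
    then show ?thesis
      using eK ew(3) by blast
  qed
  have Rww: "polar q w (\<kappa> w) = 0" if w: "w \<in> Kp" for w
  proof -
    define a c where "a = x \<bullet> x" and "c = w \<bullet> w"
    have w_plus: "w \<in> plus_space"
      using w by (simp add: Kp_def)
    have xw: "x \<bullet> w = 0" "w \<bullet> x = 0"
      using w xK by (auto simp: Kp_def inner_commute)
    have skew: "C \<alpha> (C \<beta> e) \<bullet> e = 0" if "\<alpha> \<in> {1..3}" "\<beta> \<in> {1..3}" "\<alpha> \<noteq> \<beta>" for \<alpha> \<beta> e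
      using that orthogonal_C[of \<beta> \<alpha> e] by (simp add: adjoint_C)
    define R where "R = (\<lambda>i e f. polar (ps ! i) e (\<kappa> f))"
    have R_diag: "(\<Sum>i<length ps. (R i e e)\<^sup>2) = (e \<bullet> e)\<^sup>2" if "e \<in> plus_space" for e
      using identity[OF that that] skew by (simp add: R_def power2_eq_square)
    have xx: "(\<Sum>i<length ps. (R i x x)\<^sup>2) = a\<^sup>2"
      using R_diag[OF x_plus] by (simp add: a_def)
    have ww: "(\<Sum>i<length ps. (R i w w)\<^sup>2) = c\<^sup>2"
      using R_diag[OF w_plus] by (simp add: c_def)
    have xw': "(\<Sum>i<length ps. (R i x w)\<^sup>2) = a * c"
      using identity[OF x_plus w_plus] K_CC[OF xK] w unfolding R_def a_def c_def by (auto simp: Kp_def)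
    have pp: "(\<Sum>i<length ps. (R i (x + w) (x + w))\<^sup>2) = (a + c)\<^sup>2"
      using R_diag[OF subspace_add[OF subspace_plus x_plus w_plus]] xw
      by (simp add: a_def c_def inner_add_left inner_add_right)
    have mm: "(\<Sum>i<length ps. (R i (x - w) (x - w))\<^sup>2) = (a + c)\<^sup>2"
      using R_diag[OF subspace_diff[OF subspace_plus x_plus w_plus]] xw
      by (simp add: a_def c_def inner_diff_left inner_diff_right)
    have \<kappa>_add: "\<kappa> (u + v) = \<kappa> u + \<kappa> v" "\<kappa> (u - v) = \<kappa> u - \<kappa> v" for u v
      by (simp_all add: \<kappa>_def C_add C_diff)
    have mem: "ps ! i \<in> fun_space.span (set ps)" if "i < length ps" for i
      using that by (auto intro: summand_in_span)
    have Rp: "R i (x + w) (x + w) = R i x x + R i w w + 2 * R i x w"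
      "R i (x - w) (x - w) = R i x x + R i w w - 2 * R i x w" if "i < length ps" for i
      using polar_simps[OF mem[OF that]] R_sym[OF mem[OF that], of w x]
      by (simp_all add: R_def \<kappa>_add)
    \<comment> \<open>The mixed product of \<open>R i x x\<close> and \<open>R i w w\<close> is
      eliminated through the values at \<open>x + w\<close> and \<open>x - w\<close>, whose sums of
      squares are known. The weights \<open>c\<close> and \<open>a\<close> replace normalization to
      unit vectors; the total is 0, so every term vanishes.\<close>
    have "(\<Sum>i<length ps. (c * R i x x + a * R i w w)\<^sup>2) =
      (\<Sum>i<length ps. (c\<^sup>2 - a * c) * (R i x x)\<^sup>2 + (a\<^sup>2 - a * c) * (R i w w)\<^sup>2
        + a * c / 2 * (R i (x + w) (x + w))\<^sup>2 + a * c / 2 * (R i (x - w) (x - w))\<^sup>2 - 4 * a * c * (R i x w)\<^sup>2)"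
      by (intro sum.cong refl) (simp only: Rp lessThan_iff, simp add: power2_eq_square field_simps)
    also have "\<dots> = (c\<^sup>2 - a * c) * a\<^sup>2 + (a\<^sup>2 - a * c) * c\<^sup>2
        + a * c / 2 * (a + c)\<^sup>2 + a * c / 2 * (a + c)\<^sup>2 - 4 * a * c * (a * c)"
      unfolding sum.distrib sum_subtractf sum_distrib_left[symmetric] xx ww pp mm xw' ..
    also have "\<dots> = 0"
      by (simp add: power2_eq_square field_simps)
    finally have "c * R i x x + a * R i w w = 0" if "i < length ps" for i
      using that by (subst (asm) sum_nonneg_eq_0_iff) auto
    then have "c * polar f x (\<kappa> x) + a * polar f w (\<kappa> w) = 0" if "f \<in> set ps" for f
      using that unfolding in_set_conv_nth R_def by auto
    moreover have "fun_space.subspace {f. c * polar f x (\<kappa> x) + a * polar f w (\<kappa> w) = 0}"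
    proof -
      have "c * (s + s') + a * (t + t') = (c * s + a * t) + (c * s' + a * t')"
        and "c * (k * s) + a * (k * t) = k * (c * s + a * t)" for k s t s' t'
        by (simp_all add: algebra_simps)
      then show ?thesis
        by (intro fun_space.subspaceI)
          (simp_all add: polar_fun_zero polar_fun_add polar_fun_scale del: distrib_left)
    qed
    ultimately have "fun_space.span (set ps) \<subseteq> {f. c * polar f x (\<kappa> x) + a * polar f w (\<kappa> w) = 0}"
      by (intro fun_space.span_minimal) auto
    then have "c * polar q x (\<kappa> x) + a * polar q w (\<kappa> w) = 0"
      using q by blast
    moreover have "polar q x (\<kappa> x) = 0"
      using xK \<kappa>_minus[OF x_plus] by (simp add: K_def)
    ultimately show ?thesis
      using x(2) by (simp add: a_def)
  qed
  have Rvw: "polar q v (\<kappa> w) = 0" if "v \<in> Kp" "w \<in> Kp" for v w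
    using Rww[OF Kp_add[OF that]] Rww[OF that(1)] Rww[OF that(2)] R_sym[OF q, of v w] polar_simps[OF q]
    by (simp add: \<kappa>_def C_add)
  \<comment> \<open>The form vanishes on \<open>Kp\<close> against \<open>Kp\<close> by
    \<open>Rvw\<close>, and on \<open>Kp\<close> against \<open>K\<close> by symmetry and the
    definition of \<open>K\<close>. So \<open>w\<close> lies in \<open>K\<close> and in its
    orthogonal complement.\<close>
  have "w = 0" if w: "w \<in> Kp" for w
  proof -
    have w_plus: "w \<in> plus_space"
      using w by (simp add: Kp_def)
    have "polar q w y = 0" if y: "y \<in> minus_space" for y
    proof -
      have "- \<kappa> y \<in> plus_space"
        using \<kappa>_plus[OF y] subspace_plus subspace_neg by blast
      then obtain e v where ev: "e \<in> K" "v \<in> Kp" "- \<kappa> y = e + v"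
        using decomp by blast
      have "y = \<kappa> (- \<kappa> y)"
        using \<kappa>_\<kappa>[of y] by (simp add: \<kappa>_def C_minus)
      also have "\<dots> = \<kappa> e + \<kappa> v"
        unfolding ev(3) by (simp add: \<kappa>_def C_add)
      finally have "polar q w y = polar q w (\<kappa> e) + polar q w (\<kappa> v)"
        using polar_simps[OF q] by simp
      moreover have "polar q e (\<kappa> w) = 0"
        using ev(1) \<kappa>_minus[OF w_plus] by (simp add: K_def)
      ultimately show ?thesis
        using Rvw[OF w ev(2)] R_sym[OF q, of w e] by simp
    qed
    then have "w \<in> K"
      using w_plus by (simp add: K_def)
    then have "w \<bullet> w = 0"
      using w by (auto simp: Kp_def)
    then show ?thesis
      by simp
  qed
  then have plus_K: "plus_space \<subseteq> K"
    using decomp by fastforce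
  show "q = 0"
  proof
    fix v
    obtain y z where yz: "y \<in> plus_space" "z \<in> minus_space" "v = y + z"
      using plus_minus_decomposition .
    then have "polar q y z = 0"
      using plus_K by (auto simp: K_def)
    then show "q v = 0 v"
      using polar_same_sign[OF q] yz polar_simps(9)[OF q, of v] polar_simps(1-2)[OF q]
      by (simp add: polar_commute[of q z y])
  qed
qed

section \<open>Lagrange's identity\<close>

lemma lagrange_identity_real:
  fixes a b :: "nat \<Rightarrow> real"
  shows "(\<Sum>i<n. (a i)\<^sup>2) * (\<Sum>i<n. (b i)\<^sup>2) - (\<Sum>i<n. a i * b i)\<^sup>2 =
    (\<Sum>j<n. \<Sum>i<j. (a i * b j - a j * b i)\<^sup>2)"
proof (induction n)
  case (Suc n)
  have "(\<Sum>i<n. (a i * b n - a n * b i)\<^sup>2) =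
      (\<Sum>i<n. (b n)\<^sup>2 * (a i)\<^sup>2 + (a n)\<^sup>2 * (b i)\<^sup>2 - 2 * a n * b n * (a i * b i))"
    by (intro sum.cong refl) (simp add: power2_eq_square algebra_simps)
  also have "\<dots> = (b n)\<^sup>2 * (\<Sum>i<n. (a i)\<^sup>2) + (a n)\<^sup>2 * (\<Sum>i<n. (b i)\<^sup>2) - 2 * a n * b n * (\<Sum>i<n. a i * b i)"
    by (simp add: sum.distrib sum_subtractf sum_distrib_left)
  finally show ?case
    using Suc.IH by (simp add: power2_eq_square algebra_simps)
qed simp

lemma lagrange_identity_complex:
  fixes a b :: "nat \<Rightarrow> complex"
  shows "(\<Sum>i<n. (cmod (a i))\<^sup>2) * (\<Sum>i<n. (cmod (b i))\<^sup>2) - (cmod (\<Sum>i<n. a i * cnj (b i)))\<^sup>2 =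
    (\<Sum>j<n. \<Sum>i<j. (cmod (a i * b j - a j * b i))\<^sup>2)"
proof (induction n)
  case (Suc n)
  define D where "D = (\<Sum>i<n. a i * cnj (b i))"
  have "(\<Sum>i<n. (cmod (a i * b n - a n * b i))\<^sup>2) =
      (\<Sum>i<n. (cmod (b n))\<^sup>2 * (cmod (a i))\<^sup>2 + (cmod (a n))\<^sup>2 * (cmod (b i))\<^sup>2
        - 2 * Re (cnj (a n) * b n * (a i * cnj (b i))))"
    by (intro sum.cong refl) (simp only: cmod_power2, simp add: power2_eq_square algebra_simps)
  also have "\<dots> = (cmod (b n))\<^sup>2 * (\<Sum>i<n. (cmod (a i))\<^sup>2) + (cmod (a n))\<^sup>2 * (\<Sum>i<n. (cmod (b i))\<^sup>2)
      - 2 * Re (cnj (a n) * b n * D)"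
    by (simp only: D_def sum.distrib sum_subtractf sum_distrib_left Re_sum)
  finally have "(\<Sum>i<n. (cmod (a i * b n - a n * b i))\<^sup>2) = \<dots>" .
  moreover have "(cmod (D + a n * cnj (b n)))\<^sup>2 =
      (cmod D)\<^sup>2 + (cmod (a n))\<^sup>2 * (cmod (b n))\<^sup>2 + 2 * Re (cnj (a n) * b n * D)"
    by (simp only: cmod_power2, simp add: power2_eq_square algebra_simps)
  ultimately show ?case
    using Suc.IH by (simp add: D_def[symmetric] algebra_simps)
qed simp

lemma sum_list_triangle:
  fixes g :: "'b \<Rightarrow> real"
  shows "(\<Sum>q\<leftarrow>[f j i. j \<leftarrow> [0..<n], i \<leftarrow> [0..<j]]. g q) = (\<Sum>j<n. \<Sum>i<j. g (f j i))"
  by (induction n) (simp_all add: interv_sum_list_conv_sum_set_nat atLeast0LessThan o_def)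

lemma sum_list_triangle_Re_Im:
  fixes g :: "'b \<Rightarrow> real"
  shows "(\<Sum>q\<leftarrow>[f j i h. j \<leftarrow> [0..<n], i \<leftarrow> [0..<j], h \<leftarrow> [Re, Im]]. g q) =
    (\<Sum>j<n. \<Sum>i<j. g (f j i Re) + g (f j i Im))"
proof (induction n)
  case (Suc n)
  have "(\<Sum>q\<leftarrow>[f n i h. i \<leftarrow> [0..<k], h \<leftarrow> [Re, Im]]. g q) = (\<Sum>i<k. g (f n i Re) + g (f n i Im))" for k
    by (induction k) simp_all
  then show ?case
    using Suc by simp
qed simp

text \<open>Folding the square of indices along the diagonal turns skew coefficients of products
  into coefficients of the 2 x 2 minors in Lagrange's identity.\<close>

lemma sum_skew_triangle:
  fixes s c :: "nat \<Rightarrow> nat \<Rightarrow> real"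
  assumes skew: "\<And>i j. s i j = - s j i"
  shows "(\<Sum>i<n. \<Sum>j<n. s i j * c i j) = (\<Sum>j<n. \<Sum>i<j. s i j * (c i j - c j i))"
proof (induction n)
  case (Suc n)
  have "s n n = 0"
    using skew[of n n] by simp
  moreover have "(\<Sum>j<n. s n j * c n j) = (\<Sum>i<n. - (s i n * c n i))"
    by (intro sum.cong refl) (metis skew mult_minus_left)
  ultimately show ?case
    using Suc by (simp add: sum.distrib right_diff_distrib sum_subtractf sum_negf)
qed simp

lemma card_triangle: "real (card (SIGMA j:{..<n}. {..<j})) = real n * (real n - 1) / 2"
proof -
  have "card (SIGMA j:{..<n}. {..<j}) = (\<Sum>j<n. j)"
    by simp
  also have "real \<dots> = real n * (real n - 1) / 2"
    by (induction n) (simp_all add: field_simps)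
  finally show ?thesis .
qed

lemma linear_real_polynomial_function:
  fixes f :: "'a::euclidean_space \<Rightarrow> real"
  shows "linear f \<Longrightarrow> real_polynomial_function f"
  using linear_conv_bounded_linear by (intro real_polynomial_function.intros(1)) blast

section \<open>Coordinates adapted to a Clifford system\<close>

text \<open>\<open>C 1\<close> maps an orthonormal basis of the plus space to one of the minus
  space. The index set is arbitrary since the complex case takes a disjoint sum of two copies of
  \<open>{..<n}\<close>.\<close>

lemma (in clifford_operators) parseval_plus:
  assumes m: "1 \<le> m" and dim: "DIM('a) = 2 * l" and I: "finite I" "card I = l"
    and v: "orthonormal_family I v" "v ` I \<subseteq> plus_space"
  shows "x = (\<Sum>i\<in>I. (v i \<bullet> x) *\<^sub>R v i) + (\<Sum>i\<in>I. (C 1 (v i) \<bullet> x) *\<^sub>R C 1 (v i))"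
    and "x \<bullet> y = (\<Sum>i\<in>I. (v i \<bullet> x) * (v i \<bullet> y)) + (\<Sum>i\<in>I. (C 1 (v i) \<bullet> x) * (C 1 (v i) \<bullet> y))"
proof -
  define w where "w = case_sum v (\<lambda>i. C 1 (v i))"
  have "v i \<bullet> C 1 (v j) = 0" "C 1 (v j) \<bullet> v i = 0" if "i \<in> I" "j \<in> I" for i j
    using plus_minus_orthogonal[of "v i" "C 1 (v j)"] C_plus_minus[of 1 "v j"] that v m by auto
  moreover have "v i \<bullet> v j = (if i = j then 1 else 0)" if "i \<in> I" "j \<in> I" for i j
    using v(1) that by (simp add: orthonormal_family_def)
  ultimately have w: "orthonormal_family (I <+> I) w"
    using m by (simp add: orthonormal_family_def w_def isometry_C Plus_def ball_Un)
  have expand: "z = (\<Sum>i\<in>I. (v i \<bullet> z) *\<^sub>R v i) + (\<Sum>i\<in>I. (C 1 (v i) \<bullet> z) *\<^sub>R C 1 (v i))" for z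
  proof -
    have "z = (\<Sum>i\<in>I <+> I. (w i \<bullet> z) *\<^sub>R w i)"
      using I dim by (intro orthonormal_family_expansion[OF _ w _ subspace_UNIV]) (auto simp: card_Plus)
    also have "\<dots> = (\<Sum>i\<in>I. (v i \<bullet> z) *\<^sub>R v i) + (\<Sum>i\<in>I. (C 1 (v i) \<bullet> z) *\<^sub>R C 1 (v i))"
      using I by (simp add: sum.Plus w_def)
    finally show ?thesis .
  qed
  then show "x = (\<Sum>i\<in>I. (v i \<bullet> x) *\<^sub>R v i) + (\<Sum>i\<in>I. (C 1 (v i) \<bullet> x) *\<^sub>R C 1 (v i))" .
  show "x \<bullet> y = (\<Sum>i\<in>I. (v i \<bullet> x) * (v i \<bullet> y)) + (\<Sum>i\<in>I. (C 1 (v i) \<bullet> x) * (C 1 (v i) \<bullet> y))"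
    by (subst expand[of x]) (simp add: inner_add_left inner_sum_left)
qed

lemma (in clifford_sos) form_expansion:
  assumes dim: "DIM('a) = 2 * l" and I: "finite I" "card I = l"
    and v: "orthonormal_family I v" "v ` I \<subseteq> plus_space" and q: "q \<in> fun_space.span (set ps)"
  shows "q x = 2 * (\<Sum>i\<in>I. \<Sum>j\<in>I. polar q (v i) (C 1 (v j)) * ((v i \<bullet> x) * (C 1 (v j) \<bullet> x)))"
proof -
  define y z where "y = (\<Sum>i\<in>I. (v i \<bullet> x) *\<^sub>R v i)" and "z = (\<Sum>i\<in>I. (C 1 (v i) \<bullet> x) *\<^sub>R C 1 (v i))"
  have x: "x = y + z"
    unfolding y_def z_def by (rule parseval_plus(1)[OF m_pos dim I v])
  have "y \<in> plus_space" "z \<in> minus_space"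
    unfolding y_def z_def using v(2) m_pos C_plus_minus
    by (auto intro!: subspace_sum subspace_scale subspace_plus subspace_minus)
  then have "q x = 2 * polar q y z"
    using polar_same_sign[OF q] polar_simps(9)[OF q, of x] polar_simps(1-2)[OF q]
    by (simp add: x polar_commute[of q z y])
  also have "polar q y z = (\<Sum>i\<in>I. \<Sum>j\<in>I. (v i \<bullet> x) * ((C 1 (v j) \<bullet> x) * polar q (v i) (C 1 (v j))))"
  proof -
    have lin: "linear (polar q u)" "linear (\<lambda>u'. polar q u' u)" for u
      using span_quadratic_form[OF q] by (simp_all add: quadratic_form_def bilinear_def)
    have "polar q y z = (\<Sum>i\<in>I. (v i \<bullet> x) * polar q (v i) z)"
      by (simp add: y_def linear_sum[OF lin(2)] linear_scale[OF lin(2)])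
    moreover have "polar q u z = (\<Sum>j\<in>I. (C 1 (v j) \<bullet> x) * polar q u (C 1 (v j)))" for u
      by (simp add: z_def linear_sum[OF lin(1)] linear_scale[OF lin(1)])
    ultimately show ?thesis
      by (simp add: sum_distrib_left)
  qed
  finally show ?thesis
    by (simp add: mult.commute mult.left_commute)
qed

lemma (in clifford_operators) form_0_1:
  assumes m: "1 \<le> m" and dim: "DIM('a) = 2 * l" and I: "finite I" "card I = l"
    and v: "orthonormal_family I v" "v ` I \<subseteq> plus_space"
  shows "x \<bullet> x = (\<Sum>i\<in>I. (v i \<bullet> x)\<^sup>2) + (\<Sum>i\<in>I. (C 1 (v i) \<bullet> x)\<^sup>2)"
    and "C 0 x \<bullet> x = (\<Sum>i\<in>I. (v i \<bullet> x)\<^sup>2) - (\<Sum>i\<in>I. (C 1 (v i) \<bullet> x)\<^sup>2)"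
    and "C 1 x \<bullet> x = 2 * (\<Sum>i\<in>I. (v i \<bullet> x) * (C 1 (v i) \<bullet> x))"
proof -
  note parseval = parseval_plus(2)[OF m dim I v]
  show "x \<bullet> x = (\<Sum>i\<in>I. (v i \<bullet> x)\<^sup>2) + (\<Sum>i\<in>I. (C 1 (v i) \<bullet> x)\<^sup>2)"
    using parseval[of x x] by (simp add: power2_eq_square)
  have "v i \<bullet> C 0 x = v i \<bullet> x" "C 1 (v i) \<bullet> C 0 x = - (C 1 (v i) \<bullet> x)" if "i \<in> I" for i
    using that v(2) adjoint_C[of 0 "v i" x] adjoint_C[of 0 "C 1 (v i)" x] C_plus_minus[of 1 "v i"] m
    by (auto simp: plus_space_def minus_space_def image_subset_iff)
  then show "C 0 x \<bullet> x = (\<Sum>i\<in>I. (v i \<bullet> x)\<^sup>2) - (\<Sum>i\<in>I. (C 1 (v i) \<bullet> x)\<^sup>2)"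
    using parseval[of "C 0 x" x] by (simp add: power2_eq_square sum_negf)
  have "v i \<bullet> C 1 x = C 1 (v i) \<bullet> x" "C 1 (v i) \<bullet> C 1 x = v i \<bullet> x" for i
    using m by (simp_all add: adjoint_C involution_C)
  then show "C 1 x \<bullet> x = 2 * (\<Sum>i\<in>I. (v i \<bullet> x) * (C 1 (v i) \<bullet> x))"
    using parseval[of "C 1 x" x] by (simp add: mult.commute)
qed

text \<open>The coordinates \<open>a\<close> and \<open>b\<close> are the components in the two
  eigenspaces, identified by \<open>C 1\<close>. The forms of \<open>C 0\<close> and
  \<open>C 1\<close> are then |a|^2 - |b|^2 and 2 <a, b>. Anticommutation with \<open>C 1\<close>
  makes the coefficient matrix of each summand skew, which places it in the span of the
  minors.\<close>

lemma real_lagrange_coordinates: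
  fixes C :: "nat \<Rightarrow> 'a::euclidean_space \<Rightarrow> 'a"
  assumes "clifford_operators 1 C" and dim: "DIM('a) = 2 * l"
  obtains a b where "isometric_coordinates l a b"
    "\<And>x. clifford_G 1 C x =
      4 * ((\<Sum>i<l. (a i x)\<^sup>2) * (\<Sum>i<l. (b i x)\<^sup>2) - (\<Sum>i<l. a i x * b i x)\<^sup>2)"
    "real (sos_rank [\<lambda>x. 2 * (a i x * b j x - a j x * b i x). j \<leftarrow> [0..<l], i \<leftarrow> [0..<j]]) = real l * (real l - 1) / 2"
    "\<And>ps. sos_representation (clifford_G 1 C) ps \<Longrightarrow>
      set ps \<subseteq> fun_space.span (set [\<lambda>x. 2 * (a i x * b j x - a j x * b i x). j \<leftarrow> [0..<l], i \<leftarrow> [0..<j]])"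
proof -
  interpret clifford_operators 1 C by fact
  note One_nat_def [simp del]
  have "dim plus_space = l"
    using dim_eigenspaces[OF _ dim] by simp
  then obtain v where v: "orthonormal_family {..<l} v" "v ` {..<l} \<subseteq> plus_space"
    using orthonormal_family_exists[OF subspace_plus] by metis
  define a b where "a = (\<lambda>i x. v i \<bullet> x)" and "b = (\<lambda>i x. C 1 (v i) \<bullet> x)"
  define f where "f = (\<lambda>(j, i) x. 2 * (a i x * b j x - a j x * b i x))"
  let ?T = "SIGMA j:{..<l}. {..<j}"
  let ?L = "[\<lambda>x. 2 * (a i x * b j x - a j x * b i x). j \<leftarrow> [0..<l], i \<leftarrow> [0..<j]]"
  have set_L: "set ?L = f ` ?T"
    by (fastforce simp: f_def)
  have forms: "x \<bullet> x = (\<Sum>i<l. (a i x)\<^sup>2) + (\<Sum>i<l. (b i x)\<^sup>2)"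
    "C 0 x \<bullet> x = (\<Sum>i<l. (a i x)\<^sup>2) - (\<Sum>i<l. (b i x)\<^sup>2)"
    "C 1 x \<bullet> x = 2 * (\<Sum>i<l. a i x * b i x)" for x
    using form_0_1[OF order_refl dim finite_lessThan card_lessThan v, of x] by (simp_all only: a_def b_def)
  show thesis
  proof
    show "isometric_coordinates l a b"
      unfolding isometric_coordinates_def
      using forms(1) by (auto simp: a_def b_def dot_square_norm inner_add_right intro!: linearI)
    fix x
    show "clifford_G 1 C x = 4 * ((\<Sum>i<l. (a i x)\<^sup>2) * (\<Sum>i<l. (b i x)\<^sup>2) - (\<Sum>i<l. a i x * b i x)\<^sup>2)"
    proof -
      have "norm x ^ 4 = (x \<bullet> x)\<^sup>2"
        by (simp add: dot_square_norm)
      moreover have "{..1::nat} = {0, 1}"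
        by auto
      moreover have "(s + t)\<^sup>2 - ((s - t)\<^sup>2 + (2 * y)\<^sup>2) = 4 * (s * t - y\<^sup>2)" for s t y :: real
        by (simp add: power2_eq_square algebra_simps)
      ultimately show ?thesis
        by (simp add: clifford_G_def forms)
    qed
  next
    have "fun_space.dim (f ` ?T) = card ?T"
    proof (rule dim_eq_card_if_dual_points)
      fix s t assume st: "s \<in> ?T" "t \<in> ?T"
      obtain j i j' i' where eq: "s = (j, i)" "t = (j', i')"
        by (metis surj_pair)
      have vv: "v k \<bullet> v k' = (if k = k' then 1 else 0)" "v k \<bullet> C 1 (v k') = 0" "C 1 (v k') \<bullet> v k = 0"
        if "k < l" "k' < l" for k k'
        using v plus_minus_orthogonal[of "v k" "C 1 (v k')"] C_plus_minus[of 1 "v k'"] that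
        by (auto simp: orthonormal_family_def)
      \<comment> \<open>At this point \<open>a\<close> and \<open>b\<close> are coordinate vectors.
        Only the product \<open>a i x * b j x\<close> of a minor can be nonzero, because both index
        pairs are strictly increasing.\<close>
      show "f s ((\<lambda>(j, i). v i + C 1 (v j)) t) = (if s = t then 2 else 0)"
        using st vv by (auto simp: eq f_def a_def b_def inner_add_right isometry_C)
    qed auto
    then show "real (sos_rank ?L) = real l * (real l - 1) / 2"
      unfolding sos_rank_def fun_space.dim_span set_L using card_triangle by simp
  next
    fix ps assume "sos_representation (clifford_G 1 C) ps"
    then interpret clifford_sos 1 C ps
      by unfold_locales simp_all
    show "set ps \<subseteq> fun_space.span (set ?L)"
      unfolding set_L
    proof
      fix q assume "q \<in> set ps"
      then have q: "q \<in> fun_space.span (set ps)"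
        by (rule summand_in_span)
      define s where "s = (\<lambda>i j. polar q (v i) (C 1 (v j)))"
      have skew: "s i j = - s j i" for i j
        using polar_C[OF q, of 1 "v i" "v j"] by (simp add: s_def polar_commute[of q "v j"])
      have "q x = (\<Sum>j<l. \<Sum>i<j. s i j * f (j, i) x)" for x
      proof -
        have "q x = 2 * (\<Sum>i<l. \<Sum>j<l. s i j * (a i x * b j x))"
          using form_expansion[OF dim finite_lessThan card_lessThan v q] by (simp add: s_def a_def b_def)
        also have "\<dots> = 2 * (\<Sum>j<l. \<Sum>i<j. s i j * (a i x * b j x - a j x * b i x))"
          using sum_skew_triangle[of s "\<lambda>i j. a i x * b j x" l, OF skew] by simp
        finally show ?thesis
          by (simp add: f_def sum_distrib_left algebra_simps)
      qed
      then have "q = (\<Sum>t\<in>?T. (\<lambda>x. s (snd t) (fst t) * f t x))"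
        by (simp add: fun_eq_iff sum_fun_apply sum.Sigma split_def)
      also have "\<dots> \<in> fun_space.span (f ` ?T)"
        by (intro fun_space.span_sum fun_space.span_scale fun_space.span_base imageI)
      finally show "q \<in> fun_space.span (f ` ?T)" .
    qed
  qed
qed

text \<open>\<open>C 1\<close> after \<open>C 2\<close> is a complex structure on the plus space. In
  the resulting complex coordinates the forms of \<open>C 1\<close> and \<open>C 2\<close> are, up
  to sign, twice the real and twice the imaginary part of one Hermitian product, so their squares
  add up to its squared modulus.\<close>

lemma complex_lagrange_coordinates:
  fixes C :: "nat \<Rightarrow> 'a::euclidean_space \<Rightarrow> 'a"
  assumes "clifford_operators 2 C" and dim: "DIM('a) = 2 * l"
  obtains n a b where "l = 2 * n" "isometric_coordinates n a b"
    "\<And>x. clifford_G 2 C x = 4 * ((\<Sum>i<n. (cmod (a i x))\<^sup>2) * (\<Sum>i<n. (cmod (b i x))\<^sup>2)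
        - (cmod (\<Sum>i<n. a i x * cnj (b i x)))\<^sup>2)"
    "real (sos_rank [\<lambda>x. 2 * h (a i x * b j x - a j x * b i x). j \<leftarrow> [0..<n], i \<leftarrow> [0..<j], h \<leftarrow> [Re, Im]])
      = real l * (real l - 2) / 4"
    "\<And>ps. sos_representation (clifford_G 2 C) ps \<Longrightarrow> set ps \<subseteq>
      fun_space.span (set [\<lambda>x. 2 * h (a i x * b j x - a j x * b i x). j \<leftarrow> [0..<n], i \<leftarrow> [0..<j], h \<leftarrow> [Re, Im]])"
proof -
  interpret clifford_operators 2 C by fact
  note One_nat_def [simp del]
  have anti: "C 2 (C 1 x) = - C 1 (C 2 x)" for x
    by (rule anticommute_C) auto
  have J_skew: "C 1 (C 2 x) \<bullet> y = - (x \<bullet> C 1 (C 2 y))" for x y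
    by (simp add: adjoint_C anti)
  have "\<exists>n u. dim plus_space = 2 * n \<and> u ` {..<n} \<subseteq> plus_space \<and> orthonormal_family {..<n} u \<and>
    (\<forall>i<n. \<forall>j<n. u i \<bullet> C 1 (C 2 (u j)) = 0)"
  proof (rule complex_structure_basis[OF subspace_plus])
    show "linear (\<lambda>x. C 1 (C 2 x))"
      using linear_compose[OF linear_C[of 2] linear_C[of 1]] by (simp add: o_def)
    show "(\<lambda>x. C 1 (C 2 x)) ` plus_space \<subseteq> plus_space"
      by (intro image_subsetI C_minus_plus C_plus_minus) auto
    show "C 1 (C 2 (C 1 (C 2 x))) = - x" for x
      by (simp add: anti C_minus involution_C)
  qed (rule J_skew)
  then obtain n u where n: "dim plus_space = 2 * n" and u: "u ` {..<n} \<subseteq> plus_space"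
    "orthonormal_family {..<n} u" "\<And>i j. i < n \<Longrightarrow> j < n \<Longrightarrow> u i \<bullet> C 1 (C 2 (u j)) = 0"
    by blast
  have l: "l = 2 * n"
    using dim_eigenspaces[OF _ dim] n by simp
  define I where "I = {..<n} <+> {..<n}"
  define v where "v = case_sum u (\<lambda>i. C 1 (C 2 (u i)))"
  have I: "finite I" "card I = l"
    by (simp_all add: I_def l card_Plus)
  have uu: "u i \<bullet> u j = (if i = j then 1 else 0)" if "i < n" "j < n" for i j
    using u(2) that by (simp add: orthonormal_family_def)
  have u_plus: "u i \<in> plus_space" "C 1 (C 2 (u i)) \<in> plus_space" if "i < n" for i
    using u(1) that by (auto intro!: C_minus_plus C_plus_minus)
  have uJ: "C 1 (C 2 (u j)) \<bullet> u i = 0" if "i < n" "j < n" for i j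
    using u(3)[OF that] by (simp add: inner_commute)
  have v: "orthonormal_family I v" "v ` I \<subseteq> plus_space"
    using uu u(3) uJ u_plus
    by (auto simp: orthonormal_family_def v_def I_def isometry_C Plus_def ball_Un)
  \<comment> \<open>\<open>C 1\<close> sends the imaginary direction \<open>C 1 (C 2 (u i))\<close>
    to \<open>C 2 (u i)\<close>, which explains the imaginary part of \<open>b\<close>.\<close>
  define a b where "a = (\<lambda>i x. Complex (u i \<bullet> x) (C 1 (C 2 (u i)) \<bullet> x))"
    and "b = (\<lambda>i x. Complex (C 1 (u i) \<bullet> x) (C 2 (u i) \<bullet> x))"
  define f where "f = (\<lambda>((j, i), h) x. 2 * h (a i x * b j x - a j x * b i x) :: real)"
  let ?T = "SIGMA j:{..<n}. {..<j}"
  let ?L = "[\<lambda>x. 2 * h (a i x * b j x - a j x * b i x). j \<leftarrow> [0..<n], i \<leftarrow> [0..<j], h \<leftarrow> [Re, Im]]"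
  have "?L = [f ((j, i), h). j \<leftarrow> [0..<n], i \<leftarrow> [0..<j], h \<leftarrow> [Re, Im]]"
    by (simp only: f_def prod.case)
  then have "set ?L = (\<Union>j<n. \<Union>i<j. {f ((j, i), Re), f ((j, i), Im)})"
    by (simp add: atLeast0LessThan)
  also have "\<dots> = f ` (?T \<times> {Re, Im})"
    by (auto 4 4)
  finally have set_L: "set ?L = f ` (?T \<times> {Re, Im})" .
  have C_v: "C 1 (v (Inl i)) = C 1 (u i)" "C 1 (v (Inr i)) = C 2 (u i)" for i
    by (simp_all add: v_def involution_C)
  have sum_I: "(\<Sum>s\<in>I. g s) = (\<Sum>i<n. g (Inl i)) + (\<Sum>i<n. g (Inr i))" for g :: "nat + nat \<Rightarrow> real"
    by (simp add: I_def sum.Plus)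
  have m1: "(1::nat) \<le> 2"
    by simp
  have A: "(\<Sum>s\<in>I. (v s \<bullet> x)\<^sup>2) = (\<Sum>i<n. (cmod (a i x))\<^sup>2)" for x
    by (simp add: sum_I v_def a_def cmod_power2 sum.distrib)
  have B: "(\<Sum>s\<in>I. (C 1 (v s) \<bullet> x)\<^sup>2) = (\<Sum>i<n. (cmod (b i x))\<^sup>2)" for x
    by (simp add: sum_I C_v b_def cmod_power2 sum.distrib)
  have form1: "C 1 x \<bullet> x = 2 * Re (\<Sum>i<n. a i x * cnj (b i x))" for x
    using form_0_1(3)[OF m1 dim I v, of x]
    by (simp add: sum_I v_def a_def b_def sum.distrib involution_C)
  have form2: "C 2 x \<bullet> x = - 2 * Im (\<Sum>i<n. a i x * cnj (b i x))" for x
  proof -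
    have "C 2 x \<bullet> x = (\<Sum>s\<in>I. (v s \<bullet> C 2 x) * (v s \<bullet> x)) + (\<Sum>s\<in>I. (C 1 (v s) \<bullet> C 2 x) * (C 1 (v s) \<bullet> x))"
      by (rule parseval_plus(2)[OF m1 dim I v])
    moreover have "C 1 (C 2 y) \<bullet> C 2 x = - (C 1 y \<bullet> x)" "C 1 y \<bullet> C 2 x = - (C 1 (C 2 y) \<bullet> x)"
      "C 2 y \<bullet> C 2 x = y \<bullet> x" "y \<bullet> C 2 x = C 2 y \<bullet> x" for y
      using adjoint_C[of 2 "C 1 (C 2 y)" x] adjoint_C[of 2 "C 1 y" x]
      by (simp_all add: anti C_minus involution_C isometry_C adjoint_C)
    ultimately show ?thesis
      by (simp add: sum_I v_def a_def b_def involution_C sum.distrib sum_negf sum_subtractf algebra_simps)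
  qed
  show thesis
  proof
    show "l = 2 * n"
      by (rule l)
    show "isometric_coordinates n a b"
      unfolding isometric_coordinates_def
    proof (intro conjI allI impI)
      show "linear (a i)" "linear (b i)" for i
        by (auto intro!: linearI simp: a_def b_def complex_eq_iff inner_add_right)
      show "(norm x)\<^sup>2 = (\<Sum>i<n. (cmod (a i x))\<^sup>2) + (\<Sum>i<n. (cmod (b i x))\<^sup>2)" for x
        using form_0_1(1)[OF m1 dim I v, of x] by (simp only: A B dot_square_norm)
    qed
    fix x
    show "clifford_G 2 C x = 4 * ((\<Sum>i<n. (cmod (a i x))\<^sup>2) * (\<Sum>i<n. (cmod (b i x))\<^sup>2)
        - (cmod (\<Sum>i<n. a i x * cnj (b i x)))\<^sup>2)"
    proof -
      have "norm x ^ 4 = (x \<bullet> x)\<^sup>2"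
        by (simp add: dot_square_norm)
      moreover have "{..2::nat} = {0, 1, 2}"
        by auto
      moreover have "(s + t)\<^sup>2 - ((s - t)\<^sup>2 + ((2 * y)\<^sup>2 + (- 2 * z)\<^sup>2)) = 4 * (s * t - (y\<^sup>2 + z\<^sup>2))"
        for s t y z :: real
        by (simp add: power2_eq_square algebra_simps)
      ultimately show ?thesis
        using form_0_1(1,2)[OF m1 dim I v, of x]
        by (simp add: clifford_G_def form1 form2 A B cmod_power2 del: Re_sum Im_sum)
    qed
  next
    have "fun_space.dim (f ` (?T \<times> {Re, Im})) = card (?T \<times> {Re, Im})"
    proof (rule dim_eq_card_if_dual_points)
      have Re_Im: "Re \<noteq> Im"
        by (metis complex.sel zero_neq_one)
      fix s t assume st: "s \<in> ?T \<times> {Re, Im}" "t \<in> ?T \<times> {Re, Im}"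
      obtain j i h j' i' h' where eq: "s = ((j, i), h)" "t = ((j', i'), h')"
        by (metis surj_pair)
      have ij: "i < j" "j < n" "i' < j'" "j' < n" and h: "h = Re \<or> h = Im" "h' = Re \<or> h' = Im"
        using st eq by auto
      \<comment> \<open>The choice between \<open>C 1 (u j)\<close> and \<open>C 2 (u j)\<close>
        makes the matching minor 1 or the imaginary unit, so that exactly one of \<open>Re\<close>
        and \<open>Im\<close> sees it.\<close>
      define p where "p = (\<lambda>((j, i), h). u i + (if h = Re then C 1 (u j) else C 2 (u j)))"
      have orth: "u k \<bullet> C 1 (u k') = 0" "u k \<bullet> C 2 (u k') = 0"
          "C 1 (u k') \<bullet> u k = 0" "C 2 (u k') \<bullet> u k = 0"
          "C 1 (C 2 (u k)) \<bullet> C 1 (u k') = 0" "C 1 (C 2 (u k)) \<bullet> C 2 (u k') = 0"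
        if "k < n" "k' < n" for k k'
        using that u_plus plus_minus_orthogonal C_plus_minus[of 1 "u k'"] C_plus_minus[of 2 "u k'"] by auto
      have orth': "C 1 (u k) \<bullet> C 2 (u k') = 0" "C 2 (u k) \<bullet> C 1 (u k') = 0" if "k < n" "k' < n" for k k'
        using u(3)[OF that] u(3)[OF that(2,1)] by (simp_all add: adjoint_C anti inner_commute)
      have a_p: "a k (p t) = (if k = i' then 1 else 0)" if "k < n" for k
        using that ij uu uJ orth by (auto simp: a_def p_def eq inner_add_right complex_eq_iff)
      have b_p: "b k (p t) = (if k = j' then (if h' = Re then 1 else \<i>) else 0)" if "k < n" for k
        using that ij uu orth orth' by (auto simp: b_def p_def eq inner_add_right complex_eq_iff isometry_C)
      show "f s (p t) = (if s = t then 2 else 0)"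
      proof -
        have lt: "i < n" "j < n"
          using ij by auto
        have "f s (p t) = 2 * h (a i (p t) * b j (p t) - a j (p t) * b i (p t))"
          by (simp add: f_def eq(1))
        then show ?thesis
          unfolding a_p[OF lt(1)] a_p[OF lt(2)] b_p[OF lt(1)] b_p[OF lt(2)]
          using ij h Re_Im by (auto simp: eq)
      qed
    qed auto
    moreover have "Re \<noteq> Im"
      by (metis complex.sel zero_neq_one)
    then have "card (?T \<times> {Re, Im}) = 2 * card ?T"
      by (simp only: card_cartesian_product) simp
    ultimately show "real (sos_rank ?L) = real l * (real l - 2) / 4"
      unfolding sos_rank_def fun_space.dim_span set_L using card_triangle[of n] l
      by (simp add: field_simps)
  next
    fix ps assume "sos_representation (clifford_G 2 C) ps"
    then interpret clifford_sos 2 C ps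
      by unfold_locales simp_all
    show "set ps \<subseteq> fun_space.span (set ?L)"
      unfolding set_L
    proof
      fix q assume "q \<in> set ps"
      then have q: "q \<in> fun_space.span (set ps)"
        by (rule summand_in_span)
      define s t where "s = (\<lambda>i j. polar q (u i) (C 1 (u j)))" and "t = (\<lambda>i j. polar q (u i) (C 2 (u j)))"
      have C1: "polar q (C 1 x) y = - polar q x (C 1 y)" and C2: "polar q (C 2 x) y = - polar q x (C 2 y)" for x y
        by (rule polar_C[OF q]; simp)+
      have skew: "s i j = - s j i" "t i j = - t j i" for i j
        using C1[of "u i" "u j"] C2[of "u i" "u j"]
        by (simp_all add: s_def t_def polar_commute[of q "u j"])
      \<comment> \<open>Anticommutation with \<open>C 1\<close> and \<open>C 2\<close> leaves two
        skew blocks \<open>s\<close> and \<open>t\<close>. Their pattern in the four blocks of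
        coefficients is that of the real and imaginary parts of a product of complex
        numbers.\<close>
      have J: "polar q (C 1 (C 2 (u i))) (C 1 (u j)) = t i j" "polar q (C 1 (C 2 (u i))) (C 2 (u j)) = - s i j" for i j
        by (simp_all add: s_def t_def C1 C2 anti involution_C C_minus polar_simps[OF q])
      have st: "polar q (u i) (C 1 (u j)) = s i j" "polar q (u i) (C 2 (u j)) = t i j" for i j
        by (simp_all add: s_def t_def)
      have "q x = (\<Sum>j<n. \<Sum>i<j. s i j * f ((j, i), Re) x) + (\<Sum>j<n. \<Sum>i<j. t i j * f ((j, i), Im) x)" for x
      proof -
        have "q x = 2 * (\<Sum>i<n. \<Sum>j<n. s i j * Re (a i x * b j x)) + 2 * (\<Sum>i<n. \<Sum>j<n. t i j * Im (a i x * b j x))"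
          unfolding form_expansion[OF dim I v q, of x] sum_I C_v
          by (simp add: v_def J st a_def b_def sum.distrib[symmetric]
              sum_distrib_left algebra_simps)
        also have "\<dots> = 2 * (\<Sum>j<n. \<Sum>i<j. s i j * (Re (a i x * b j x) - Re (a j x * b i x))) +
            2 * (\<Sum>j<n. \<Sum>i<j. t i j * (Im (a i x * b j x) - Im (a j x * b i x)))"
          using sum_skew_triangle[of s "\<lambda>i j. Re (a i x * b j x)" n, OF skew(1)]
            sum_skew_triangle[of t "\<lambda>i j. Im (a i x * b j x)" n, OF skew(2)] by simp
        finally show ?thesis
          by (simp add: f_def sum_distrib_left algebra_simps)
      qed
      then have "q = (\<Sum>e\<in>?T. (\<lambda>x. s (snd e) (fst e) * f (e, Re) x)) + (\<Sum>e\<in>?T. (\<lambda>x. t (snd e) (fst e) * f (e, Im) x))"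
        by (simp add: fun_eq_iff sum_fun_apply sum.Sigma split_def)
      also have "\<dots> \<in> fun_space.span (f ` (?T \<times> {Re, Im}))"
        by (intro fun_space.span_add fun_space.span_sum fun_space.span_scale fun_space.span_base imageI) auto
      finally show "q \<in> fun_space.span (f ` (?T \<times> {Re, Im}))" .
    qed
  qed
qed

section \<open>Representations of minimal rank\<close>

text \<open>Complementary Pluecker coordinates are paired; the cross terms cancel by the Pluecker relation
  \<open>p\<^sub>0\<^sub>1p\<^sub>2\<^sub>3 - p\<^sub>0\<^sub>2p\<^sub>1\<^sub>3 + p\<^sub>0\<^sub>3p\<^sub>1\<^sub>2 = 0\<close>.\<close>

lemma plucker_sum_squares:
  fixes a b :: "nat \<Rightarrow> complex"
  defines "p \<equiv> \<lambda>i j. a i * b j - a j * b i"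
  shows "(\<Sum>j<4. \<Sum>i<j. (cmod (p i j))\<^sup>2) =
    (cmod (p 0 1 + cnj (p 2 3)))\<^sup>2 + (cmod (p 0 2 - cnj (p 1 3)))\<^sup>2 + (cmod (p 0 3 + cnj (p 1 2)))\<^sup>2"
proof -
  have "p 0 1 * p 2 3 - p 0 2 * p 1 3 + p 0 3 * p 1 2 = 0"
    by (simp add: p_def algebra_simps)
  then have rel: "Re (p 0 1 * p 2 3) - Re (p 0 2 * p 1 3) + Re (p 0 3 * p 1 2) = 0"
    by (metis minus_complex.sel(1) plus_complex.sel(1) zero_complex.sel(1))
  have sq: "(cmod (z + cnj w))\<^sup>2 = (cmod z)\<^sup>2 + (cmod w)\<^sup>2 + 2 * Re (z * w)"
    "(cmod (z - cnj w))\<^sup>2 = (cmod z)\<^sup>2 + (cmod w)\<^sup>2 - 2 * Re (z * w)" for z w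
    by (simp_all only: cmod_power2, simp_all add: power2_eq_square algebra_simps)
  have "{..<4} = {0, 1, 2, 3::nat}" "{..<3} = {0, 1, 2::nat}" "{..<2} = {0, 1::nat}" "{..<1} = {0::nat}"
    by auto
  then have "(\<Sum>j<4. \<Sum>i<j. (cmod (p i j))\<^sup>2) = (cmod (p 0 1))\<^sup>2 + ((cmod (p 0 2))\<^sup>2 + (cmod (p 1 2))\<^sup>2)
      + ((cmod (p 0 3))\<^sup>2 + (cmod (p 1 3))\<^sup>2 + (cmod (p 2 3))\<^sup>2)"
    by simp
  then show ?thesis
    using rel unfolding sq by simp
qed

text \<open>For n = 2 there is a single complex minor, hence two real squares. For n = 4 the six
  minors combine into three complex terms by \<open>plucker_sum_squares\<close>, hence six real
  squares.\<close>

lemma lagrange_few_squares: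
  fixes a b :: "nat \<Rightarrow> 'v::real_normed_vector \<Rightarrow> complex"
  assumes n: "n = 2 \<or> n = 4"
    and poly: "\<And>i. i < n \<Longrightarrow> real_polynomial_function (\<lambda>x. Re (a i x))"
      "\<And>i. i < n \<Longrightarrow> real_polynomial_function (\<lambda>x. Im (a i x))"
      "\<And>i. i < n \<Longrightarrow> real_polynomial_function (\<lambda>x. Re (b i x))"
      "\<And>i. i < n \<Longrightarrow> real_polynomial_function (\<lambda>x. Im (b i x))"
  obtains qs where "\<forall>q\<in>set qs. real_polynomial_function q" "length qs = 2 * n - 2"
    "\<And>x. (\<Sum>q\<leftarrow>qs. (q x)\<^sup>2) = 4 * ((\<Sum>i<n. (cmod (a i x))\<^sup>2) * (\<Sum>i<n. (cmod (b i x))\<^sup>2)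
        - (cmod (\<Sum>i<n. a i x * cnj (b i x)))\<^sup>2)"
proof -
  define p where "p = (\<lambda>i j x. a i x * b j x - a j x * b i x)"
  have p: "real_polynomial_function (\<lambda>x. Re (p i j x))" "real_polynomial_function (\<lambda>x. Im (p i j x))"
    if "i < n" "j < n" for i j
    using that poly by (auto simp: p_def intro!: real_polynomial_function_diff real_polynomial_function.intros(3,4))
  show thesis
    using n
  proof
    assume n: "n = 2"
    show thesis
    proof (rule that)
      show "\<forall>q\<in>set [\<lambda>x. 2 * Re (p 0 1 x), \<lambda>x. 2 * Im (p 0 1 x)]. real_polynomial_function q"
        using p[of 0 1] n by (auto intro!: real_polynomial_function.intros(2,4))
      show "length [\<lambda>x. 2 * Re (p 0 1 x), \<lambda>x. 2 * Im (p 0 1 x)] = 2 * n - 2"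
        by (simp add: n)
      fix x
      show "(\<Sum>q\<leftarrow>[\<lambda>x. 2 * Re (p 0 1 x), \<lambda>x. 2 * Im (p 0 1 x)]. (q x)\<^sup>2) =
        4 * ((\<Sum>i<n. (cmod (a i x))\<^sup>2) * (\<Sum>i<n. (cmod (b i x))\<^sup>2) - (cmod (\<Sum>i<n. a i x * cnj (b i x)))\<^sup>2)"
      proof -
        have "(\<Sum>j<n. \<Sum>i<j. (cmod (a i x * b j x - a j x * b i x))\<^sup>2) = (cmod (p 0 1 x))\<^sup>2"
          by (simp add: n p_def lessThan_Suc numeral_2_eq_2)
        then show ?thesis
          unfolding lagrange_identity_complex by (simp add: cmod_power2 power_mult_distrib)
      qed
    qed
  next
    assume n: "n = 4"
    define r where "r = (\<lambda>k::nat. \<lambda>x. if k = 0 then p 0 1 x + cnj (p 2 3 x)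
        else if k = 1 then p 0 2 x - cnj (p 1 3 x) else p 0 3 x + cnj (p 1 2 x))"
    let ?qs = "[\<lambda>x. 2 * h (r k x). k \<leftarrow> [0, 1, 2], h \<leftarrow> [Re, Im]]"
    have "real_polynomial_function (\<lambda>x. 2 * Re (r k x))" "real_polynomial_function (\<lambda>x. 2 * Im (r k x))" for k
      unfolding r_def using n
      by (cases "k = 0"; cases "k = 1"; auto intro!: p real_polynomial_function.intros(2-4) real_polynomial_function_diff)+
    then have poly_qs: "\<forall>q\<in>set ?qs. real_polynomial_function q"
      by simp
    show thesis
    proof (rule that[OF poly_qs])
      show "length ?qs = 2 * n - 2"
        by (simp add: n)
      fix x
      have "(\<Sum>q\<leftarrow>?qs. (q x)\<^sup>2) = 4 * ((cmod (r 0 x))\<^sup>2 + (cmod (r 1 x))\<^sup>2 + (cmod (r 2 x))\<^sup>2)"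
        by (simp add: cmod_power2 power_mult_distrib)
      then show "(\<Sum>q\<leftarrow>?qs. (q x)\<^sup>2) =
        4 * ((\<Sum>i<n. (cmod (a i x))\<^sup>2) * (\<Sum>i<n. (cmod (b i x))\<^sup>2) - (cmod (\<Sum>i<n. a i x * cnj (b i x)))\<^sup>2)"
        unfolding lagrange_identity_complex n plucker_sum_squares by (simp add: r_def p_def)
    qed
  qed
qed

lemma sos_rank_le_length: "sos_rank ps \<le> length ps"
  using sos_rank_le_card[OF fun_space.span_superset finite_set, of ps] card_length[of ps] by linarith

lemma sum_lessThan_add: "(\<Sum>i<n + k. f i) = (\<Sum>i<n. f i) + (\<Sum>i<k. f (n + i))"
  for f :: "nat \<Rightarrow> 'a::comm_monoid_add"
  by (induction k) (simp_all add: add.assoc)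

text \<open>Pairing real coordinates into complex ones, the squared real inner product is the
  squared modulus of the Hermitian product minus the square of its imaginary part. So the real
  expression is the complex one plus one further square, \<open>q0\<close>.\<close>

lemma real_lagrange_few_squares:
  fixes a b :: "nat \<Rightarrow> 'v::real_normed_vector \<Rightarrow> real"
  assumes l: "l = 4 \<or> l = 8"
    and poly: "\<And>i. i < l \<Longrightarrow> real_polynomial_function (a i)" "\<And>i. i < l \<Longrightarrow> real_polynomial_function (b i)"
  obtains qs where "\<forall>q\<in>set qs. real_polynomial_function q" "length qs = l - 1"
    "\<And>x. (\<Sum>q\<leftarrow>qs. (q x)\<^sup>2) =
      4 * ((\<Sum>i<l. (a i x)\<^sup>2) * (\<Sum>i<l. (b i x)\<^sup>2) - (\<Sum>i<l. a i x * b i x)\<^sup>2)"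
proof -
  define n where "n = l div 2"
  have n: "n = 2 \<or> n = 4" "l = n + n"
    using l by (auto simp: n_def)
  define A B where "A = (\<lambda>i x. Complex (a i x) (a (n + i) x))" and "B = (\<lambda>i x. Complex (b i x) (b (n + i) x))"
  obtain qs where qs: "\<forall>q\<in>set qs. real_polynomial_function q" "length qs = 2 * n - 2"
    "\<And>x. (\<Sum>q\<leftarrow>qs. (q x)\<^sup>2) = 4 * ((\<Sum>i<n. (cmod (A i x))\<^sup>2) * (\<Sum>i<n. (cmod (B i x))\<^sup>2)
        - (cmod (\<Sum>i<n. A i x * cnj (B i x)))\<^sup>2)"
    by (rule lagrange_few_squares[OF n(1), of A B]) (use poly n in \<open>auto simp: A_def B_def\<close>)
  define q0 where "q0 = (\<lambda>x. 2 * Im (\<Sum>i<n. A i x * cnj (B i x)))"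
  have "real_polynomial_function q0"
    unfolding q0_def Im_sum using poly n
    by (auto simp: A_def B_def intro!: real_polynomial_function_sum real_polynomial_function_diff
        real_polynomial_function.intros(2-4))
  moreover have "(q0 x)\<^sup>2 + (\<Sum>q\<leftarrow>qs. (q x)\<^sup>2) =
      4 * ((\<Sum>i<l. (a i x)\<^sup>2) * (\<Sum>i<l. (b i x)\<^sup>2) - (\<Sum>i<l. a i x * b i x)\<^sup>2)" for x
  proof -
    have "(\<Sum>i<l. (a i x)\<^sup>2) = (\<Sum>i<n. (cmod (A i x))\<^sup>2)" "(\<Sum>i<l. (b i x)\<^sup>2) = (\<Sum>i<n. (cmod (B i x))\<^sup>2)"
      "(\<Sum>i<l. a i x * b i x) = Re (\<Sum>i<n. A i x * cnj (B i x))"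
      by (simp_all add: n sum_lessThan_add A_def B_def cmod_power2 sum.distrib)
    then show ?thesis
      unfolding qs(3) q0_def cmod_power2 by (simp only: power_mult_distrib right_diff_distrib) simp
  qed
  moreover have "length (q0 # qs) = l - 1"
    using n qs(2) by auto
  ultimately show thesis
    using that[of "q0 # qs"] qs(1) by simp
qed

text \<open>The list is first shortened to its rank; \<open>rank_lower_bound\<close> for the
  shortened list then fixes its length at exactly \<open>l - m\<close>, so that the extended system
  has indices from 0 to \<open>l\<close>.\<close>

lemma (in clifford_sos) hurwitz_if_minimal_rank:
  assumes dim: "DIM('a) = 2 * l" and l: "3 \<le> l" and rank: "m + sos_rank ps = l"
  shows "l = 4 \<or> l = 8"
proof -
  obtain qs where qs: "sos_representation (clifford_G m C) qs" "length qs \<le> sos_rank ps"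
    using sos_representation_reduce[OF sos] .
  interpret reduced: clifford_sos m C qs
    using qs(1) m_pos by unfold_locales
  have "m + length qs = l"
    using reduced.rank_lower_bound[OF dim] sos_rank_le_length[of qs] qs(2) rank by linarith
  then have "clifford_operators l (\<lambda>\<alpha>. if \<alpha> \<le> m then C \<alpha> else form_operator (qs ! (\<alpha> - m - 1)))"
    using reduced.clifford_extension[OF dim] by simp
  then show ?thesis
    using clifford_operators.hurwitz_condition dim l by blast
qed

lemma (in clifford_sos) rank_upper_bound:
  assumes dim: "DIM('a) = 2 * l" and m: "3 \<le> m"
  shows "m + sos_rank ps \<le> l"
proof -
  \<comment> \<open>Injectivity is proved for this larger list and inherited by the span of
    \<open>ps\<close>. The dimension count still uses the original system, which is why the bound is
    \<open>l - m\<close> and not \<open>l - 3\<close>.\<close>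
  define qs where "qs = ps @ map (\<lambda>\<alpha> x. C \<alpha> x \<bullet> x) [4..<Suc m]"
  have poly: "real_polynomial_function (\<lambda>x. C \<alpha> x \<bullet> x)" if "\<alpha> \<le> m" for \<alpha>
  proof -
    have lin: "linear (\<lambda>x. C \<alpha> x \<bullet> e)" "linear (\<lambda>x. x \<bullet> e)" for e
      using that by (intro linearI; simp add: C_add linear_scale[OF linear_C] inner_add_left)+
    have "real_polynomial_function (\<lambda>x. (C \<alpha> x \<bullet> e) * (x \<bullet> e))" for e
      using lin[THEN linear_real_polynomial_function] by (rule real_polynomial_function.intros(4))
    then have "real_polynomial_function (\<lambda>x. \<Sum>e\<in>Basis. (C \<alpha> x \<bullet> e) * (x \<bullet> e))"
      by (rule real_polynomial_function_sum[OF finite_Basis])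
    then show ?thesis
      unfolding euclidean_inner[symmetric] .
  qed
  have "clifford_operators 3 C"
  proof (rule clifford_operators.intro)
    fix \<alpha> \<beta> :: nat and x assume "\<alpha> \<le> 3" "\<beta> \<le> 3" "\<alpha> \<noteq> \<beta>"
    then show "C \<alpha> (C \<beta> x) = - C \<beta> (C \<alpha> x)"
      using m by (intro anticommute_C) auto
  qed (use m in \<open>simp_all add: linear_C adjoint_C involution_C\<close>)
  moreover have "sos_representation (clifford_G 3 C) qs"
    unfolding sos_representation_def
  proof (intro conjI allI)
    show "\<forall>q\<in>set qs. real_polynomial_function q"
      using sos poly by (auto simp: qs_def sos_representation_def)
    fix x
    have "{..m} = {..3} \<union> {4..m}"
      using m by auto
    then have "(\<Sum>\<alpha>\<le>m. (C \<alpha> x \<bullet> x)\<^sup>2) = (\<Sum>\<alpha>\<le>3. (C \<alpha> x \<bullet> x)\<^sup>2) + (\<Sum>\<alpha>=4..m. (C \<alpha> x \<bullet> x)\<^sup>2)"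
      by (simp add: sum.union_disjoint)
    moreover have "(\<Sum>q\<leftarrow>qs. (q x)\<^sup>2) = clifford_G m C x + (\<Sum>\<alpha>=4..m. (C \<alpha> x \<bullet> x)\<^sup>2)"
      using sos by (simp add: qs_def sos_representation_def o_def interv_sum_list_conv_sum_set_nat
          atLeastLessThanSuc_atLeastAtMost del: upt_Suc)
    ultimately show "clifford_G 3 C x = (\<Sum>q\<leftarrow>qs. (q x)\<^sup>2)"
      by (simp add: clifford_G_def)
  qed
  ultimately have sos3: "clifford_sos 3 C qs"
    by (simp add: clifford_sos_def clifford_sos_axioms_def)
  have "dim plus_space \<noteq> 0"
    using dim_eigenspaces[OF m_pos dim] dim by (metis DIM_positive mult_is_0 not_gr_zero)
  then obtain x where x: "x \<in> plus_space" "x \<noteq> 0"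
    unfolding dim_eq_0 by blast
  have "fun_space.span (set ps) \<subseteq> fun_space.span (set qs)"
    by (intro fun_space.span_mono) (auto simp: qs_def)
  then show ?thesis
    using x clifford_sos_3_injective[OF sos3, of _ x]
    by (intro rank_upper_bound_if_injective[OF dim x]) (auto simp: plus_space_def minus_space_def)
qed

section \<open>Rank bounds\<close>

lemma symmetric_clifford_system_operators:
  fixes P :: "nat \<Rightarrow> real^'n^'n"
  assumes "symmetric_clifford_system m P"
  shows "clifford_operators m (\<lambda>\<alpha>. (*v) (P \<alpha>))"
proof
  fix \<alpha> \<beta> :: nat and x y :: "real^'n"
  have "mat 2 = mat 1 + (mat 1 :: real^'n^'n)"
    by (simp add: mat_def vec_eq_iff)
  then have mat2: "mat 2 *v z = 2 *\<^sub>R z" for z :: "real^'n"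
    by (simp only: matrix_vector_mult_add_rdistrib matrix_vector_mul_lid scaleR_2)
  have anti: "P \<alpha> *v (P \<beta> *v x) + P \<beta> *v (P \<alpha> *v x) = (if \<alpha> = \<beta> then 2 *\<^sub>R x else 0)"
    if "\<alpha> \<le> m" "\<beta> \<le> m" for \<alpha> \<beta>
  proof -
    have "P \<alpha> *v (P \<beta> *v x) + P \<beta> *v (P \<alpha> *v x) = (P \<alpha> ** P \<beta> + P \<beta> ** P \<alpha>) *v x"
      by (simp add: matrix_vector_mult_add_rdistrib matrix_vector_mul_assoc)
    then show ?thesis
      using assms that by (simp add: symmetric_clifford_system_def mat2)
  qed
  show "P \<alpha> *v (x + y) = P \<alpha> *v x + P \<alpha> *v y" "P \<alpha> *v (c *\<^sub>R x) = c *\<^sub>R (P \<alpha> *v x)" for c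
    by (simp_all add: matrix_vector_right_distrib matrix_vector_mult_scaleR)
  assume \<alpha>: "\<alpha> \<le> m"
  show "(P \<alpha> *v x) \<bullet> y = x \<bullet> (P \<alpha> *v y)"
    using assms \<alpha> by (metis dot_lmul_matrix symmetric_clifford_system_def transpose_matrix_vector)
  show "P \<alpha> *v (P \<alpha> *v x) = x"
    using anti[OF \<alpha> \<alpha>] by (simp flip: scaleR_2)
  assume "\<beta> \<le> m" "\<alpha> \<noteq> \<beta>"
  then show "P \<alpha> *v (P \<beta> *v x) = - (P \<beta> *v (P \<alpha> *v x))"
    using anti[OF \<alpha>] by (simp add: eq_neg_iff_add_eq_0)
qed

lemma G_poly_eq_clifford_G: "G_poly m P = clifford_G m (\<lambda>\<alpha>. (*v) (P \<alpha>))"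
  by (simp add: fun_eq_iff G_poly_def clifford_G_def)

lemma sos_rank_mono:
  assumes "set ps \<subseteq> fun_space.span (set qs)"
  shows "sos_rank ps \<le> sos_rank qs"
proof -
  obtain B where B: "set qs \<subseteq> fun_space.span B" "finite B" "card B = sos_rank qs"
    "fun_space.span B = fun_space.span (set qs)"
    using sos_rank_basis .
  show ?thesis
    using sos_rank_le_card[of ps B] assms B by simp
qed

text \<open>The Lagrange terms are independent and span every representation, so their rank is
  maximal. For \<open>l = 4\<close> and \<open>l = 8\<close> the length of the short list caps its
  rank at the lower bound.\<close>

lemma rank_bounds_m_1:
  fixes C :: "nat \<Rightarrow> 'a::euclidean_space \<Rightarrow> 'a"
  assumes C: "clifford_operators 1 C" and dim: "DIM('a) = 2 * l" and l: "3 \<le> l"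
  shows "\<forall>ps. sos_representation (clifford_G 1 C) ps \<longrightarrow>
      real l - 1 \<le> real (sos_rank ps) \<and> real (sos_rank ps) \<le> real l * (real l - 1) / 2"
    and "\<exists>ps. sos_representation (clifford_G 1 C) ps \<and> real (sos_rank ps) = real l * (real l - 1) / 2 \<and>
      real_lagrange_representation l (clifford_G 1 C) ps"
    and "(\<exists>ps. sos_representation (clifford_G 1 C) ps \<and> real (sos_rank ps) = real l - 1) \<longleftrightarrow> l = 4 \<or> l = 8"
proof -
  obtain a b where iso: "isometric_coordinates l a b"
    and G: "\<And>x. clifford_G 1 C x =
      4 * ((\<Sum>i<l. (a i x)\<^sup>2) * (\<Sum>i<l. (b i x)\<^sup>2) - (\<Sum>i<l. a i x * b i x)\<^sup>2)"
    and rank: "real (sos_rank [\<lambda>x. 2 * (a i x * b j x - a j x * b i x). j \<leftarrow> [0..<l], i \<leftarrow> [0..<j]]) =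
      real l * (real l - 1) / 2"
    and span: "\<And>ps. sos_representation (clifford_G 1 C) ps \<Longrightarrow> set ps \<subseteq>
      fun_space.span (set [\<lambda>x. 2 * (a i x * b j x - a j x * b i x). j \<leftarrow> [0..<l], i \<leftarrow> [0..<j]])"
    using real_lagrange_coordinates[OF C dim] by blast
  let ?L = "[\<lambda>x. 2 * (a i x * b j x - a j x * b i x). j \<leftarrow> [0..<l], i \<leftarrow> [0..<j]]"
  have poly: "real_polynomial_function (a i)" "real_polynomial_function (b i)" if "i < l" for i
    using iso that by (auto simp: isometric_coordinates_def intro: linear_real_polynomial_function)
  have sos: "clifford_sos 1 C ps" if "sos_representation (clifford_G 1 C) ps" for ps
    using C that by (simp add: clifford_sos_def clifford_sos_axioms_def)
  have lower: "l - 1 \<le> sos_rank ps" if "sos_representation (clifford_G 1 C) ps" for ps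
    using clifford_sos.rank_lower_bound[OF sos[OF that] dim] by simp
  show "\<forall>ps. sos_representation (clifford_G 1 C) ps \<longrightarrow>
      real l - 1 \<le> real (sos_rank ps) \<and> real (sos_rank ps) \<le> real l * (real l - 1) / 2"
  proof (intro allI impI conjI)
    fix ps assume ps: "sos_representation (clifford_G 1 C) ps"
    show "real l - 1 \<le> real (sos_rank ps)"
      using lower[OF ps] by linarith
    show "real (sos_rank ps) \<le> real l * (real l - 1) / 2"
      unfolding rank[symmetric] using sos_rank_mono[OF span[OF ps]] by simp
  qed
  have "real_polynomial_function (\<lambda>x. 2 * (a i x * b j x - a j x * b i x))" if "i < l" "j < l" for i j
    using that by (intro real_polynomial_function.intros(2-4) real_polynomial_function_diff poly)
  then have "real_polynomial_function q" if "q \<in> set ?L" for q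
    using that by auto
  moreover have "clifford_G 1 C x = (\<Sum>q\<leftarrow>?L. (q x)\<^sup>2)" for x
    unfolding sum_list_triangle G lagrange_identity_real
    by (simp only: power_mult_distrib sum_distrib_left) simp
  ultimately have "sos_representation (clifford_G 1 C) ?L"
    unfolding sos_representation_def by blast
  then show "\<exists>ps. sos_representation (clifford_G 1 C) ps \<and> real (sos_rank ps) = real l * (real l - 1) / 2 \<and>
      real_lagrange_representation l (clifford_G 1 C) ps"
    using rank iso G unfolding real_lagrange_representation_def by blast
  show "(\<exists>ps. sos_representation (clifford_G 1 C) ps \<and> real (sos_rank ps) = real l - 1) \<longleftrightarrow> l = 4 \<or> l = 8"
  proof
    assume "\<exists>ps. sos_representation (clifford_G 1 C) ps \<and> real (sos_rank ps) = real l - 1"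
    then obtain ps where ps: "sos_representation (clifford_G 1 C) ps" "real (sos_rank ps) = real l - 1"
      by blast
    then have "1 + sos_rank ps = l"
      by linarith
    then show "l = 4 \<or> l = 8"
      by (rule clifford_sos.hurwitz_if_minimal_rank[OF sos[OF ps(1)] dim l])
  next
    assume l48: "l = 4 \<or> l = 8"
    obtain qs where qs: "\<forall>q\<in>set qs. real_polynomial_function q" "length qs = l - 1"
      "\<And>x. (\<Sum>q\<leftarrow>qs. (q x)\<^sup>2) =
        4 * ((\<Sum>i<l. (a i x)\<^sup>2) * (\<Sum>i<l. (b i x)\<^sup>2) - (\<Sum>i<l. a i x * b i x)\<^sup>2)"
      using real_lagrange_few_squares[of l a b, OF l48] poly by blast
    then have "sos_representation (clifford_G 1 C) qs"
      unfolding sos_representation_def G by simp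
    moreover from this have "real (sos_rank qs) = real l - 1"
      using lower[of qs] sos_rank_le_length[of qs] qs(2) l by linarith
    ultimately show "\<exists>ps. sos_representation (clifford_G 1 C) ps \<and> real (sos_rank ps) = real l - 1"
      by blast
  qed
qed

text \<open>The complex coordinates force \<open>l\<close> to be even; \<open>l = 4\<close> and
  \<open>l = 8\<close> correspond to \<open>n = 2\<close> and \<open>n = 4\<close> in
  \<open>lagrange_few_squares\<close>.\<close>

lemma rank_bounds_m_2:
  fixes C :: "nat \<Rightarrow> 'a::euclidean_space \<Rightarrow> 'a"
  assumes C: "clifford_operators 2 C" and dim: "DIM('a) = 2 * l" and l: "3 \<le> l"
  shows "\<forall>ps. sos_representation (clifford_G 2 C) ps \<longrightarrow>
      real l - 2 \<le> real (sos_rank ps) \<and> real (sos_rank ps) \<le> real l * (real l - 2) / 4"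
    and "\<exists>ps. sos_representation (clifford_G 2 C) ps \<and> real (sos_rank ps) = real l * (real l - 2) / 4 \<and>
      complex_lagrange_representation (l div 2) (clifford_G 2 C) ps"
    and "(\<exists>ps. sos_representation (clifford_G 2 C) ps \<and> real (sos_rank ps) = real l - 2) \<longleftrightarrow> l = 4 \<or> l = 8"
proof -
  obtain n a b where n: "l = 2 * n" and iso: "isometric_coordinates n a b"
    and G: "\<And>x. clifford_G 2 C x = 4 * ((\<Sum>i<n. (cmod (a i x))\<^sup>2) * (\<Sum>i<n. (cmod (b i x))\<^sup>2)
        - (cmod (\<Sum>i<n. a i x * cnj (b i x)))\<^sup>2)"
    and rank: "real (sos_rank [\<lambda>x. 2 * h (a i x * b j x - a j x * b i x). j \<leftarrow> [0..<n], i \<leftarrow> [0..<j], h \<leftarrow> [Re, Im]])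
      = real l * (real l - 2) / 4"
    and span: "\<And>ps. sos_representation (clifford_G 2 C) ps \<Longrightarrow> set ps \<subseteq>
      fun_space.span (set [\<lambda>x. 2 * h (a i x * b j x - a j x * b i x). j \<leftarrow> [0..<n], i \<leftarrow> [0..<j], h \<leftarrow> [Re, Im]])"
    using complex_lagrange_coordinates[OF C dim] by blast
  let ?L = "[\<lambda>x. 2 * h (a i x * b j x - a j x * b i x). j \<leftarrow> [0..<n], i \<leftarrow> [0..<j], h \<leftarrow> [Re, Im]]"
  have "linear (\<lambda>x. Re (a i x))" "linear (\<lambda>x. Im (a i x))" "linear (\<lambda>x. Re (b i x))" "linear (\<lambda>x. Im (b i x))"
    if "i < n" for i
    using iso that by (auto simp: isometric_coordinates_def linear_iff)
  note poly = this[THEN linear_real_polynomial_function]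
  have sos: "clifford_sos 2 C ps" if "sos_representation (clifford_G 2 C) ps" for ps
    using C that by (simp add: clifford_sos_def clifford_sos_axioms_def)
  have lower: "l - 2 \<le> sos_rank ps" if "sos_representation (clifford_G 2 C) ps" for ps
    using clifford_sos.rank_lower_bound[OF sos[OF that] dim] by simp
  show "\<forall>ps. sos_representation (clifford_G 2 C) ps \<longrightarrow>
      real l - 2 \<le> real (sos_rank ps) \<and> real (sos_rank ps) \<le> real l * (real l - 2) / 4"
  proof (intro allI impI conjI)
    fix ps assume ps: "sos_representation (clifford_G 2 C) ps"
    show "real l - 2 \<le> real (sos_rank ps)"
      using lower[OF ps] by linarith
    show "real (sos_rank ps) \<le> real l * (real l - 2) / 4"
      unfolding rank[symmetric] using sos_rank_mono[OF span[OF ps]] by simp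
  qed
  have "real_polynomial_function (\<lambda>x. 2 * Re (a i x * b j x - a j x * b i x))"
    "real_polynomial_function (\<lambda>x. 2 * Im (a i x * b j x - a j x * b i x))" if "i < n" "j < n" for i j
    using that by (auto intro!: poly real_polynomial_function.intros(2-4) real_polynomial_function_diff)
  then have "real_polynomial_function q" if "q \<in> set ?L" for q
    using that by (auto simp del: minus_complex.sel times_complex.sel)
  moreover have "clifford_G 2 C x = (\<Sum>q\<leftarrow>?L. (q x)\<^sup>2)" for x
  proof -
    have "4 * (cmod z)\<^sup>2 = (2 * Re z)\<^sup>2 + (2 * Im z)\<^sup>2" for z
      by (simp add: cmod_power2 power_mult_distrib)
    then show ?thesis
      unfolding sum_list_triangle_Re_Im G lagrange_identity_complex by (simp only: sum_distrib_left)
  qed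
  ultimately have "sos_representation (clifford_G 2 C) ?L"
    unfolding sos_representation_def by blast
  then show "\<exists>ps. sos_representation (clifford_G 2 C) ps \<and> real (sos_rank ps) = real l * (real l - 2) / 4 \<and>
      complex_lagrange_representation (l div 2) (clifford_G 2 C) ps"
    using rank iso G n unfolding complex_lagrange_representation_def by auto
  show "(\<exists>ps. sos_representation (clifford_G 2 C) ps \<and> real (sos_rank ps) = real l - 2) \<longleftrightarrow> l = 4 \<or> l = 8"
  proof
    assume "\<exists>ps. sos_representation (clifford_G 2 C) ps \<and> real (sos_rank ps) = real l - 2"
    then obtain ps where ps: "sos_representation (clifford_G 2 C) ps" "real (sos_rank ps) = real l - 2"
      by blast
    then have "2 + sos_rank ps = l"
      by linarith
    then show "l = 4 \<or> l = 8"
      by (rule clifford_sos.hurwitz_if_minimal_rank[OF sos[OF ps(1)] dim l])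
  next
    assume "l = 4 \<or> l = 8"
    then have n24: "n = 2 \<or> n = 4"
      using n by auto
    obtain qs where qs: "\<forall>q\<in>set qs. real_polynomial_function q" "length qs = 2 * n - 2"
      "\<And>x. (\<Sum>q\<leftarrow>qs. (q x)\<^sup>2) = 4 * ((\<Sum>i<n. (cmod (a i x))\<^sup>2) * (\<Sum>i<n. (cmod (b i x))\<^sup>2)
        - (cmod (\<Sum>i<n. a i x * cnj (b i x)))\<^sup>2)"
      using lagrange_few_squares[of n a b, OF n24] poly by blast
    then have "sos_representation (clifford_G 2 C) qs"
      by (simp add: sos_representation_def G)
    moreover from this have "real (sos_rank qs) = real l - 2"
      using lower[of qs] sos_rank_le_length[of qs] qs(2) l n by linarith
    ultimately show "\<exists>ps. sos_representation (clifford_G 2 C) ps \<and> real (sos_rank ps) = real l - 2"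
      by blast
  qed
qed

theorem theorem1p3:
  fixes P :: "nat \<Rightarrow> real^'n^'n" and m l :: nat
  assumes dim: "CARD('n) = 2 * l"
    and m_pos: "m \<ge> 1"
    and m_minus_pos: "l - m - 1 \<ge> 1"
    and clifford: "symmetric_clifford_system m P"
    and sos: "is_sos (G_poly m P)"
  shows
    "(\<forall>k\<ge>1. multiplicities m l = (1, k) \<longrightarrow>
        l = k + 2 \<and> l \<ge> 3 \<and>
        (\<forall>ps. sos_representation (G_poly m P) ps \<longrightarrow>
           real l - 1 \<le> real (sos_rank ps) \<and>
           real (sos_rank ps) \<le> real l * (real l - 1) / 2) \<and>
        (\<exists>ps. sos_representation (G_poly m P) ps \<and>
           real (sos_rank ps) = real l * (real l - 1) / 2 \<and>
           real_lagrange_representation l (G_poly m P) ps) \<and>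
        ((\<exists>ps. sos_representation (G_poly m P) ps \<and> real (sos_rank ps) = real l - 1)
           \<longleftrightarrow> l = 4 \<or> l = 8)) \<and>
     (\<forall>k\<ge>1. multiplicities m l = (2, 2 * k - 1) \<longrightarrow>
        l = 2 * k + 2 \<and> l \<ge> 4 \<and>
        (\<forall>ps. sos_representation (G_poly m P) ps \<longrightarrow>
           real l - 2 \<le> real (sos_rank ps) \<and>
           real (sos_rank ps) \<le> real l * (real l - 2) / 4) \<and>
        (\<exists>ps. sos_representation (G_poly m P) ps \<and>
           real (sos_rank ps) = real l * (real l - 2) / 4 \<and>
           complex_lagrange_representation (l div 2) (G_poly m P) ps) \<and>
        ((\<exists>ps. sos_representation (G_poly m P) ps \<and> real (sos_rank ps) = real l - 2)
           \<longleftrightarrow> l = 4 \<or> l = 8)) \<and>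
     (multiplicities m l \<in> {(3, 4), (5, 2), (6, 1)} \<or>
      multiplicities m l = (4, 3) \<and> indefinite_class P \<longrightarrow>
        {sos_rank ps | ps. sos_representation (G_poly m P) ps} = {8 - m})"
proof -
  define C where "C = (\<lambda>\<alpha>. (*v) (P \<alpha>))"
  have C: "clifford_operators m C"
    unfolding C_def by (rule symmetric_clifford_system_operators[OF clifford])
  have G: "G_poly m P = clifford_G m C"
    unfolding C_def by (rule G_poly_eq_clifford_G)
  have D: "DIM(real^'n) = 2 * l"
    using dim by simp
  \<comment> \<open>Positivity of \<open>l - m - 1\<close> rules out truncated subtraction.\<close>
  have l: "m + 2 \<le> l"
    using m_minus_pos by linarith
  \<comment> \<open>All pairs of the third case have \<open>l = 8\<close>, so both rank bounds equal
    \<open>8 - m\<close>. The set of ranks is nonempty by \<open>sos\<close>.\<close>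
  have case3: "{sos_rank ps | ps. sos_representation (G_poly m P) ps} = {8 - m}" if m: "3 \<le> m" and l8: "l = 8"
  proof -
    have "sos_rank ps = 8 - m" if "sos_representation (G_poly m P) ps" for ps
    proof -
      interpret clifford_sos m C ps
        using C that m_pos by (simp add: G clifford_sos_def clifford_sos_axioms_def)
      show ?thesis
        using rank_lower_bound[OF D] rank_upper_bound[OF D m] l8 by linarith
    qed
    moreover obtain ps where "sos_representation (G_poly m P) ps"
      using sos unfolding is_sos_def by blast
    ultimately show ?thesis
      by (auto intro!: exI[of _ ps])
  qed
  show ?thesis
  proof (intro conjI allI impI)
    fix k :: nat assume "multiplicities m l = (1, k)"
    then have mk: "m = 1" "l - m - 1 = k"
      by (auto simp: multiplicities_def)
    then show "l = k + 2" "3 \<le> l"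
      using l by linarith+
    have C1: "clifford_operators 1 C" and G1: "G_poly m P = clifford_G 1 C"
      using C G mk by simp_all
    note bounds = rank_bounds_m_1[OF C1 D \<open>3 \<le> l\<close>, folded G1]
    show "real l - 1 \<le> real (sos_rank ps)" "real (sos_rank ps) \<le> real l * (real l - 1) / 2"
      if "sos_representation (G_poly m P) ps" for ps
      using bounds(1) that by blast+
    show "\<exists>ps. sos_representation (G_poly m P) ps \<and> real (sos_rank ps) = real l * (real l - 1) / 2 \<and>
        real_lagrange_representation l (G_poly m P) ps"
      by (rule bounds(2))
    show "(\<exists>ps. sos_representation (G_poly m P) ps \<and> real (sos_rank ps) = real l - 1) \<longleftrightarrow> l = 4 \<or> l = 8"
      by (rule bounds(3))
  next
    fix k :: nat assume k: "1 \<le> k" and "multiplicities m l = (2, 2 * k - 1)"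
    then have mk: "m = 2" "l - m - 1 = 2 * k - 1"
      by (auto simp: multiplicities_def)
    then show "l = 2 * k + 2" "4 \<le> l"
      using l k by linarith+
    have l3: "3 \<le> l"
      using l mk by linarith
    have C2: "clifford_operators 2 C" and G2: "G_poly m P = clifford_G 2 C"
      using C G mk by simp_all
    note bounds = rank_bounds_m_2[OF C2 D l3, folded G2]
    show "real l - 2 \<le> real (sos_rank ps)" "real (sos_rank ps) \<le> real l * (real l - 2) / 4"
      if "sos_representation (G_poly m P) ps" for ps
      using bounds(1) that by blast+
    show "\<exists>ps. sos_representation (G_poly m P) ps \<and> real (sos_rank ps) = real l * (real l - 2) / 4 \<and>
        complex_lagrange_representation (l div 2) (G_poly m P) ps"
      by (rule bounds(2))
    show "(\<exists>ps. sos_representation (G_poly m P) ps \<and> real (sos_rank ps) = real l - 2) \<longleftrightarrow> l = 4 \<or> l = 8"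
      by (rule bounds(3))
  next
    assume "multiplicities m l \<in> {(3, 4), (5, 2), (6, 1)} \<or> multiplicities m l = (4, 3) \<and> indefinite_class P"
    then have "3 \<le> m \<and> l = 8"
      using l by (auto simp: multiplicities_def)
    then show "{sos_rank ps | ps. sos_representation (G_poly m P) ps} = {8 - m}"
      using case3 by blast
  qed
qed

end
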